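(* Let $k$ be an algebraically closed field. The simple Lie algebra $sl_2$ over $k$ is rigid: if $\delta:sl_2\to sl_2\otimes sl_2$ is a linear map such that $(sl_2,\delta)$ is a coassociative Lie algebra, then $\delta=0$.
   Context: $sl_2$ is the Lie algebra of traceless $2\times2$ matrices over $k$ with the commutator bracket. A coassociative Lie algebra is a Lie algebra $(L,[\,,\,])$ together with a linear map $\delta:L\to L\otimes L$ such that $(\delta\otimes 1)\delta=(1\otimes\delta)\delta$ (no counit is required) and, for all $a,b\in L$, $$\delta([a,b])=[a\otimes 1+1\otimes a,\delta(b)]+[\delta(a),b\otimes 1+1\otimes b]+[\delta(a),\delta(b)],$$ where this equation is taken in $U\otimes U$, $U$ being the usual universal enveloping algebra of the Lie algebra $L$, $L\otimes L$ being viewed as a subspace of $U\otimes U$, and the brackets on the right being commutators in $U\otimes U$. A Lie algebra $\mathfrak g$ is rigid if every linear map $\delta$ making $(\mathfrak g,\delta)$ a coassociative Lie algebra is zero.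
   Formalization: Characteristic 3 is excluded, since there δ(f)=e⊗e, δ(e)=δ(h)=0 is a nonzero coassociative structure; simplicity of sl_2 is a hypothesis, which excludes characteristic 2, where δ(e)=h⊗h, δ(f)=δ(h)=0 is one. *)

theory Defs
  imports
    "HOL-Analysis.Determinants"
    "HOL-Computational_Algebra.Computational_Algebra"
    "HOL-Algebra.QuotRing"
    "HOL-Algebra.Module"
    "HOL-Library.Poly_Mapping"
begin

text \<open>
  The base field is a type. Vector spaces over it are \<^locale>\<open>module\<close>s over the record
  \<open>scalars\<close>. The multiplicative part of a module record is used for associative algebras; for a
  Lie algebra its \<^const>\<open>mult\<close> component is the Lie bracket and \<^const>\<open>one\<close> plays no role.
\<close>

definition scalars :: "'k::field ring" where
  "scalars = \<lparr>carrier = UNIV, mult = (*), one = 1, zero = 0, add = (+)\<rparr>"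

definition linear_maps ::
    "('k::field, 'v, 'x) module_scheme \<Rightarrow> ('k, 'w, 'y) module_scheme \<Rightarrow> ('v \<Rightarrow> 'w) set" where
  "linear_maps V W = {f. f \<in> carrier V \<rightarrow> carrier W \<and>
     (\<forall>x\<in>carrier V. \<forall>y\<in>carrier V. f (x \<oplus>\<^bsub>V\<^esub> y) = f x \<oplus>\<^bsub>W\<^esub> f y) \<and>
     (\<forall>c. \<forall>x\<in>carrier V. f (c \<odot>\<^bsub>V\<^esub> x) = c \<odot>\<^bsub>W\<^esub> f x)}"

definition linear_span :: "('k::field, 'v, 'x) module_scheme \<Rightarrow> 'v set \<Rightarrow> 'v set" where
  "linear_span V S = \<Inter>{H. submodule H scalars V \<and> S \<subseteq> H}"

definition commutator :: "('v, 'x) ring_scheme \<Rightarrow> 'v \<Rightarrow> 'v \<Rightarrow> 'v" where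
  "commutator A x y = x \<otimes>\<^bsub>A\<^esub> y \<ominus>\<^bsub>A\<^esub> y \<otimes>\<^bsub>A\<^esub> x"

text \<open>The quotient by a subspace, which inherits a product when the subspace is an ideal.\<close>

definition quotient :: "('k::field, 'v, 'x) module_scheme \<Rightarrow> 'v set \<Rightarrow> ('k, 'v set) module" where
  "quotient A I =
    \<lparr>carrier = carrier (A Quot I), mult = mult (A Quot I), one = one (A Quot I),
     zero = zero (A Quot I), add = add (A Quot I),
     smult = (\<lambda>c X. \<Union>x\<in>X. I +>\<^bsub>A\<^esub> (c \<odot>\<^bsub>A\<^esub> x))\<rparr>"

text \<open>
  The space with basis \<^term>\<open>carrier M\<close>, multiplied by extending the operation of \<open>M\<close>
  bilinearly. The basis vector of \<open>m\<close> is \<^term>\<open>Poly_Mapping.single m 1\<close>.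
\<close>

definition monoid_algebra :: "('m, 'x) monoid_scheme \<Rightarrow> ('k::field, 'm \<Rightarrow>\<^sub>0 'k) module" where
  "monoid_algebra M =
    \<lparr>carrier = {p. Poly_Mapping.keys p \<subseteq> carrier M},
     mult = (\<lambda>p q. \<Sum>m\<in>Poly_Mapping.keys p. \<Sum>n\<in>Poly_Mapping.keys q.
       Poly_Mapping.single (m \<otimes>\<^bsub>M\<^esub> n) (Poly_Mapping.lookup p m * Poly_Mapping.lookup q n)),
     one = Poly_Mapping.single \<one>\<^bsub>M\<^esub> 1,
     zero = 0,
     add = (+),
     smult = (\<lambda>c. Poly_Mapping.map ((*) c))\<rparr>"


section \<open>Tensor products\<close>

definition tensor_relations ::
    "('k::field, 'v, 'x) module_scheme \<Rightarrow> ('k, 'w, 'y) module_scheme \<Rightarrow> ('v \<times> 'w \<Rightarrow>\<^sub>0 'k) set" where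
  "tensor_relations V W =
     {Poly_Mapping.single (x \<oplus>\<^bsub>V\<^esub> x', y) 1 - Poly_Mapping.single (x, y) 1
        - Poly_Mapping.single (x', y) 1 | x x' y.
        x \<in> carrier V \<and> x' \<in> carrier V \<and> y \<in> carrier W} \<union>
     {Poly_Mapping.single (x, y \<oplus>\<^bsub>W\<^esub> y') 1 - Poly_Mapping.single (x, y) 1
        - Poly_Mapping.single (x, y') 1 | x y y'.
        x \<in> carrier V \<and> y \<in> carrier W \<and> y' \<in> carrier W} \<union>
     {Poly_Mapping.single (c \<odot>\<^bsub>V\<^esub> x, y) 1 - Poly_Mapping.single (x, y) c | c x y.
        x \<in> carrier V \<and> y \<in> carrier W} \<union>
     {Poly_Mapping.single (x, c \<odot>\<^bsub>W\<^esub> y) 1 - Poly_Mapping.single (x, y) c | c x y.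
        x \<in> carrier V \<and> y \<in> carrier W}"

definition tensor_kernel ::
    "('k::field, 'v, 'x) module_scheme \<Rightarrow> ('k, 'w, 'y) module_scheme \<Rightarrow> ('v \<times> 'w \<Rightarrow>\<^sub>0 'k) set" where
  "tensor_kernel V W = linear_span (monoid_algebra (V \<times>\<times> W)) (tensor_relations V W)"

text \<open>For algebras \<open>V\<close>, \<open>W\<close> the product is \<open>(x \<otimes> y) (x' \<otimes> y') = x x' \<otimes> y y'\<close>.\<close>

definition tensor ::
    "('k::field, 'v, 'x) module_scheme \<Rightarrow> ('k, 'w, 'y) module_scheme
      \<Rightarrow> ('k, ('v \<times> 'w \<Rightarrow>\<^sub>0 'k) set) module" where
  "tensor V W = quotient (monoid_algebra (V \<times>\<times> W)) (tensor_kernel V W)"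

definition pure_tensor ::
    "('k::field, 'v, 'x) module_scheme \<Rightarrow> ('k, 'w, 'y) module_scheme
      \<Rightarrow> 'v \<Rightarrow> 'w \<Rightarrow> ('v \<times> 'w \<Rightarrow>\<^sub>0 'k) set" where
  "pure_tensor V W x y =
     tensor_kernel V W +>\<^bsub>monoid_algebra (V \<times>\<times> W)\<^esub> Poly_Mapping.single (x, y) 1"

text \<open>
  The linear map to \<open>X\<close> that sends \<open>x \<otimes> y\<close> to \<open>\<beta> x y\<close>, for \<open>\<beta>\<close> bilinear: all representatives
  of the class \<open>T\<close> have the same image.
\<close>

definition tensor_lift ::
    "('k::field, 'z, 'x) module_scheme \<Rightarrow> ('v \<Rightarrow> 'w \<Rightarrow> 'z) \<Rightarrow> ('v \<times> 'w \<Rightarrow>\<^sub>0 'k) set \<Rightarrow> 'z" where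
  "tensor_lift X \<beta> T =
     the_elem ((\<lambda>p. \<Oplus>\<^bsub>X\<^esub>k\<in>Poly_Mapping.keys p.
       Poly_Mapping.lookup p k \<odot>\<^bsub>X\<^esub> \<beta> (fst k) (snd k)) ` T)"

text \<open>\<open>f \<otimes> g\<close>, where \<open>V\<close> and \<open>W\<close> are the codomains of \<open>f\<close> and \<open>g\<close>.\<close>

definition tensor_map ::
    "('k::field, 'v, 'x) module_scheme \<Rightarrow> ('k, 'w, 'y) module_scheme
      \<Rightarrow> ('a \<Rightarrow> 'v) \<Rightarrow> ('b \<Rightarrow> 'w) \<Rightarrow> ('a \<times> 'b \<Rightarrow>\<^sub>0 'k) set \<Rightarrow> ('v \<times> 'w \<Rightarrow>\<^sub>0 'k) set" where
  "tensor_map V W f g = tensor_lift (tensor V W) (\<lambda>x y. pure_tensor V W (f x) (g y))"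

text \<open>The canonical map \<open>(V \<otimes> W) \<otimes> X \<rightarrow> V \<otimes> (W \<otimes> X)\<close>.\<close>

definition tensor_assoc ::
    "('k::field, 'v, 'x) module_scheme \<Rightarrow> ('k, 'w, 'y) module_scheme \<Rightarrow> ('k, 'u, 'z) module_scheme
      \<Rightarrow> (('v \<times> 'w \<Rightarrow>\<^sub>0 'k) set \<times> 'u \<Rightarrow>\<^sub>0 'k) set \<Rightarrow> ('v \<times> ('w \<times> 'u \<Rightarrow>\<^sub>0 'k) set \<Rightarrow>\<^sub>0 'k) set" where
  "tensor_assoc V W X =
     tensor_lift (tensor V (tensor W X))
       (\<lambda>t z. tensor_lift (tensor V (tensor W X))
          (\<lambda>x y. pure_tensor V (tensor W X) x (pure_tensor W X y z)) t)"


section \<open>Lie algebras and enveloping algebras\<close>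

locale lie_algebra = module scalars L
  for L :: "('k::field, 'v, 'x) module_scheme" (structure) +
  assumes bracket_closed: "\<lbrakk>x \<in> carrier L; y \<in> carrier L\<rbrakk> \<Longrightarrow> x \<otimes>\<^bsub>L\<^esub> y \<in> carrier L"
    and bracket_add_left: "\<lbrakk>x \<in> carrier L; y \<in> carrier L; z \<in> carrier L\<rbrakk>
      \<Longrightarrow> (x \<oplus>\<^bsub>L\<^esub> y) \<otimes>\<^bsub>L\<^esub> z = x \<otimes>\<^bsub>L\<^esub> z \<oplus>\<^bsub>L\<^esub> y \<otimes>\<^bsub>L\<^esub> z"
    and bracket_add_right: "\<lbrakk>x \<in> carrier L; y \<in> carrier L; z \<in> carrier L\<rbrakk>
      \<Longrightarrow> x \<otimes>\<^bsub>L\<^esub> (y \<oplus>\<^bsub>L\<^esub> z) = x \<otimes>\<^bsub>L\<^esub> y \<oplus>\<^bsub>L\<^esub> x \<otimes>\<^bsub>L\<^esub> z"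
    and bracket_smult_left: "\<lbrakk>x \<in> carrier L; y \<in> carrier L\<rbrakk>
      \<Longrightarrow> (c \<odot>\<^bsub>L\<^esub> x) \<otimes>\<^bsub>L\<^esub> y = c \<odot>\<^bsub>L\<^esub> (x \<otimes>\<^bsub>L\<^esub> y)"
    and bracket_smult_right: "\<lbrakk>x \<in> carrier L; y \<in> carrier L\<rbrakk>
      \<Longrightarrow> x \<otimes>\<^bsub>L\<^esub> (c \<odot>\<^bsub>L\<^esub> y) = c \<odot>\<^bsub>L\<^esub> (x \<otimes>\<^bsub>L\<^esub> y)"
    and bracket_self: "x \<in> carrier L \<Longrightarrow> x \<otimes>\<^bsub>L\<^esub> x = \<zero>\<^bsub>L\<^esub>"
    and jacobi: "\<lbrakk>x \<in> carrier L; y \<in> carrier L; z \<in> carrier L\<rbrakk>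
      \<Longrightarrow> x \<otimes>\<^bsub>L\<^esub> (y \<otimes>\<^bsub>L\<^esub> z) \<oplus>\<^bsub>L\<^esub> y \<otimes>\<^bsub>L\<^esub> (z \<otimes>\<^bsub>L\<^esub> x) \<oplus>\<^bsub>L\<^esub> z \<otimes>\<^bsub>L\<^esub> (x \<otimes>\<^bsub>L\<^esub> y) = \<zero>\<^bsub>L\<^esub>"

definition lie_ideal :: "'v set \<Rightarrow> ('k::field, 'v, 'x) module_scheme \<Rightarrow> bool" where
  "lie_ideal I L \<longleftrightarrow> submodule I scalars L \<and> (\<forall>x\<in>carrier L. \<forall>y\<in>I. x \<otimes>\<^bsub>L\<^esub> y \<in> I)"

definition simple_lie_algebra :: "('k::field, 'v, 'x) module_scheme \<Rightarrow> bool" where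
  "simple_lie_algebra L \<longleftrightarrow> lie_algebra L \<and>
     (\<exists>x\<in>carrier L. \<exists>y\<in>carrier L. x \<otimes>\<^bsub>L\<^esub> y \<noteq> \<zero>\<^bsub>L\<^esub>) \<and>
     (\<forall>I. lie_ideal I L \<longrightarrow> I = {\<zero>\<^bsub>L\<^esub>} \<or> I = carrier L)"

definition word_monoid :: "'v set \<Rightarrow> 'v list monoid" where
  "word_monoid X = \<lparr>carrier = lists X, mult = (@), one = []\<rparr>"

text \<open>
  The tensor algebra of \<open>L\<close> is the free algebra on the set \<^term>\<open>carrier L\<close> modulo the first two
  families of relations; the third family is \<open>x y - y x = [x, y]\<close>.
\<close>

definition enveloping_relations ::
    "('k::field, 'v, 'x) module_scheme \<Rightarrow> ('v list \<Rightarrow>\<^sub>0 'k) set" where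
  "enveloping_relations L =
     {Poly_Mapping.single [x \<oplus>\<^bsub>L\<^esub> y] 1 - Poly_Mapping.single [x] 1 - Poly_Mapping.single [y] 1
        | x y. x \<in> carrier L \<and> y \<in> carrier L} \<union>
     {Poly_Mapping.single [c \<odot>\<^bsub>L\<^esub> x] 1 - Poly_Mapping.single [x] c | c x. x \<in> carrier L} \<union>
     {Poly_Mapping.single [x, y] 1 - Poly_Mapping.single [y, x] 1 - Poly_Mapping.single [x \<otimes>\<^bsub>L\<^esub> y] 1
        | x y. x \<in> carrier L \<and> y \<in> carrier L}"

definition enveloping_kernel ::
    "('k::field, 'v, 'x) module_scheme \<Rightarrow> ('v list \<Rightarrow>\<^sub>0 'k) set" where
  "enveloping_kernel L =
     Idl\<^bsub>(monoid_algebra (word_monoid (carrier L)) :: ('k, 'v list \<Rightarrow>\<^sub>0 'k) module)\<^esub>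
       enveloping_relations L"

definition enveloping_algebra ::
    "('k::field, 'v, 'x) module_scheme \<Rightarrow> ('k, ('v list \<Rightarrow>\<^sub>0 'k) set) module" where
  "enveloping_algebra L =
     quotient (monoid_algebra (word_monoid (carrier L))) (enveloping_kernel L)"

definition enveloping_map ::
    "('k::field, 'v, 'x) module_scheme \<Rightarrow> 'v \<Rightarrow> ('v list \<Rightarrow>\<^sub>0 'k) set" where
  "enveloping_map L x =
     enveloping_kernel L +>\<^bsub>(monoid_algebra (word_monoid (carrier L)) :: ('k, 'v list \<Rightarrow>\<^sub>0 'k) module)\<^esub>
       Poly_Mapping.single [x] 1"


section \<open>Coassociative Lie algebras\<close>

locale coassociative_lie_algebra = lie_algebra L
  for L :: "('k::field, 'v, 'x) module_scheme" (structure)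
    and \<delta> :: "'v \<Rightarrow> ('v \<times> 'v \<Rightarrow>\<^sub>0 'k) set" +
  assumes comult_linear: "\<delta> \<in> linear_maps L (tensor L L)"
    and coassociative: "a \<in> carrier L \<Longrightarrow>
      tensor_assoc L L L (tensor_map (tensor L L) L \<delta> (\<lambda>x. x) (\<delta> a)) =
      tensor_map L (tensor L L) (\<lambda>x. x) \<delta> (\<delta> a)"
    and comult_bracket: "\<lbrakk>a \<in> carrier L; b \<in> carrier L\<rbrakk> \<Longrightarrow>
      (let U = enveloping_algebra L;
           UU = tensor U U;
           \<iota> = enveloping_map L;
           \<Delta> = (\<lambda>x. pure_tensor U U (\<iota> x) \<one>\<^bsub>U\<^esub> \<oplus>\<^bsub>UU\<^esub> pure_tensor U U \<one>\<^bsub>U\<^esub> (\<iota> x));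
           \<delta>' = (\<lambda>x. tensor_map U U \<iota> \<iota> (\<delta> x))
       in \<delta>' (a \<otimes>\<^bsub>L\<^esub> b) =
            commutator UU (\<Delta> a) (\<delta>' b) \<oplus>\<^bsub>UU\<^esub> commutator UU (\<delta>' a) (\<Delta> b)
            \<oplus>\<^bsub>UU\<^esub> commutator UU (\<delta>' a) (\<delta>' b))"

definition rigid :: "('k::field, 'v, 'x) module_scheme \<Rightarrow> bool" where
  "rigid L \<longleftrightarrow> (\<forall>\<delta>. coassociative_lie_algebra L \<delta> \<longrightarrow>
     (\<forall>x\<in>carrier L. \<delta> x = \<zero>\<^bsub>tensor L L\<^esub>))"

definition sl2 :: "('k::field, 'k^2^2) module" where
  "sl2 = \<lparr>carrier = {A. trace A = 0}, mult = (\<lambda>A B. A ** B - B ** A), one = undefined,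
     zero = 0, add = (+), smult = (\<lambda>c A. \<chi> i j. c * A $ i $ j)\<rparr>"

end

theory Submission
  imports Defs
begin

text \<open>
  Why \<open>sl\<^sub>2\<close> is rigid. Choose \<open>\<omega>\<close> with \<open>\<omega>\<^sup>2 = -1\<close>. As \<open>2 \<noteq> 0\<close>, the bracket of \<open>sl\<^sub>2\<close> is then the cross product of
  \<open>k\<^sup>3\<close> in a suitable basis, the adjoint representation has skew-symmetric matrices, and an element of \<open>L \<otimes> L\<close>
  is a \<open>3 \<times> 3\<close> matrix. Write \<open>D(a)\<close> for the matrix of \<open>\<delta>(a)\<close> and \<open>a.M\<close> for the action of \<open>a\<close> on a matrix \<open>M\<close>,
  which is the commutator of the skew-symmetric matrix of \<open>a\<close> with \<open>M\<close>.

  The compatibility of \<open>\<delta>\<close> with the bracket is one equation in \<open>U \<otimes> U\<close>, and it splits in two. To see this,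
  apply the adjoint representation, which turns it into an equation of \<open>9 \<times> 9\<close> matrices: elements of
  \<open>L \<otimes> L\<close> become symmetric matrices there, being sums of Kronecker products of two skew-symmetric ones, while the commutator \<open>[\<delta>(a), \<delta>(b)]\<close> of two symmetric matrices is skew-symmetric. Hence
  (\<open>skew_tensor_separates\<close>, with \<open>2 \<noteq> 0\<close>) the commutator vanishes, and \<open>D([a,b]) = a.D(b) - b.D(a)\<close>.

  The vanishing of \<open>[\<delta>(a), \<delta>(b)]\<close> forces \<open>D(a)\<close> and \<open>D(b)\<close> to be proportional
  (\<open>skew_tensor_commute_imp_proportional\<close>). So \<open>D(a) = \<lambda>(a) B\<close> for a linear form \<open>\<lambda>\<close> and one matrix \<open>B\<close>.
  The cocycle equation \<open>\<lambda>([a,b]) B = \<lambda>(b) a.B - \<lambda>(a) b.B\<close> then leaves only \<open>\<lambda> = 0\<close> or \<open>B = 0\<close>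
  (\<open>rank_one_cocycle_imp_zero\<close>): if neither were zero, the kernel of \<open>\<lambda>\<close> would be a Borel
  subalgebra, spanned by the usual \<open>h\<close> and \<open>e\<close> say, with \<open>e.B = 0\<close> and \<open>h.B = -2 B\<close>. But \<open>B\<close>
  commutes with \<open>ad e\<close>, so it is a polynomial in \<open>ad e\<close> and a sum of parts of weights \<open>0\<close>, \<open>2\<close> and \<open>4\<close>; none
  of these equals \<open>-2\<close> when \<open>2\<close> and \<open>3\<close> are invertible. In characteristic \<open>3\<close>, however, \<open>4 = -2\<close>, and
  \<open>\<delta>(f) = e \<otimes> e\<close>, \<open>\<delta>(e) = \<delta>(h) = 0\<close> is a nonzero coassociative structure. That \<open>2 \<noteq> 0\<close> follows from
  simplicity (\<open>simple_sl2_imp_two_neq_zero\<close>).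

  To evaluate a representation on \<open>U \<otimes> U\<close>, quotients of monoid algebras are treated uniformly: \<open>U\<close>
  and all tensor products are of this kind. It takes that the defining subspaces are ideals
  (\<open>enveloping_kernel_ideal\<close>, \<open>tensor_kernel_ideal\<close>), that matrices vanish on them
  (\<open>enveloping_kernel_eval\<close>, \<open>tensor_kernel_eval\<close>), and that \<open>f \<otimes> g\<close> acts on representatives
  (\<open>tensor_map_coset\<close>); \<open>comult_bracket_rep\<close> is the resulting matrix equation for any representation.
\<close>

no_notation fps_nth (infixl \<open>$\<close> 75)

section \<open>Linear extension from a basis\<close>

abbreviation scale :: "'k::field \<Rightarrow> ('m \<Rightarrow>\<^sub>0 'k) \<Rightarrow> ('m \<Rightarrow>\<^sub>0 'k)" where
  "scale c \<equiv> Poly_Mapping.map ((*) c)"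

lemma lookup_scale: "Poly_Mapping.lookup (scale c p) m = c * Poly_Mapping.lookup p m"
  by (simp add: Poly_Mapping.map.rep_eq when_def)

lemma scale_add: "scale c (p + q) = scale c p + scale c q"
  and scale_diff: "scale c (p - q) = scale c p - scale c q"
  and scale_left_add: "scale (c + d) p = scale c p + scale d p"
  and scale_scale: "scale c (scale d p) = scale (c * d) p"
  and scale_one: "scale 1 p = p"
  and scale_zero: "scale 0 p = 0"
  and scale_minus_one: "scale (-1) p = - p"
  and scale_zero_right: "scale c 0 = 0"
  by (auto intro!: poly_mapping_eqI simp: lookup_scale lookup_add lookup_minus algebra_simps)

text \<open>
  The linear extension of a function on a basis, in a form where the coefficient is handed to the function. This
  covers values in the field, hence entries of matrices, and values in another space of formal sums alike.
\<close>

definition extend :: "('m \<Rightarrow> 'k::zero \<Rightarrow> 'z::comm_monoid_add) \<Rightarrow> ('m \<Rightarrow>\<^sub>0 'k) \<Rightarrow> 'z" where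
  "extend f p = (\<Sum>m\<in>Poly_Mapping.keys p. f m (Poly_Mapping.lookup p m))"

lemma extend_superset:
  assumes "finite S" "Poly_Mapping.keys p \<subseteq> S" "\<And>m. f m 0 = 0"
  shows "extend f p = (\<Sum>m\<in>S. f m (Poly_Mapping.lookup p m))"
  unfolding extend_def
  by (rule sum.mono_neutral_left) (use assms in \<open>auto simp: in_keys_iff\<close>)

lemma extend_zero [simp]: "extend f 0 = 0"
  by (simp add: extend_def)

lemma extend_single: "f m 0 = 0 \<Longrightarrow> extend f (Poly_Mapping.single m a) = f m a"
  by (simp add: extend_def)

lemma extend_add:
  fixes f :: "'m \<Rightarrow> 'k::ab_group_add \<Rightarrow> 'z::ab_group_add"
  assumes f: "\<And>m a b. f m (a + b) = f m a + f m b"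
  shows "extend f (p + q) = extend f p + extend f q"
proof -
  have f0: "f m 0 = 0" for m using f[of m 0 0] by simp
  let ?S = "Poly_Mapping.keys p \<union> Poly_Mapping.keys q"
  have "extend f (p + q) = (\<Sum>m\<in>?S. f m (Poly_Mapping.lookup (p + q) m))"
    by (rule extend_superset) (auto simp: f0 dest: Poly_Mapping.keys_add[THEN subsetD])
  also have "\<dots> = extend f p + extend f q"
    by (simp add: lookup_add f sum.distrib extend_superset[of ?S _ f, OF _ _ f0])
  finally show ?thesis .
qed

lemma extend_diff:
  fixes f :: "'m \<Rightarrow> 'k::ab_group_add \<Rightarrow> 'z::ab_group_add"
  assumes f: "\<And>m a b. f m (a + b) = f m a + f m b"
  shows "extend f (p - q) = extend f p - extend f q"
  using extend_add[of f "p - q" q, OF f] by (simp add: algebra_simps)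

lemma extend_fun_add: "extend (\<lambda>m a. f m a + g m a) p = extend f p + extend g p"
  by (simp add: extend_def sum.distrib)

text \<open>
  A property that is stable under sums holds on all formal sums over \<open>S\<close> once it holds on multiples of
  basis vectors: the usual reduction of (multi)linear identities to basis vectors.
\<close>

lemma keys_subset_induct [consumes 1, case_names zero single add]:
  assumes "Poly_Mapping.keys p \<subseteq> S"
    and "P 0"
    and "\<And>m a. m \<in> S \<Longrightarrow> P (Poly_Mapping.single m a)"
    and "\<And>p q. Poly_Mapping.keys p \<subseteq> S \<Longrightarrow> Poly_Mapping.keys q \<subseteq> S \<Longrightarrow> P p \<Longrightarrow> P q \<Longrightarrow> P (p + q)"
  shows "P (p :: 'm \<Rightarrow>\<^sub>0 'k::ab_group_add)"
proof -
  have "P (\<Sum>m\<in>T. Poly_Mapping.single m (f m)) \<and> Poly_Mapping.keys (\<Sum>m\<in>T. Poly_Mapping.single m (f m)) \<subseteq> S"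
    if "finite T" "T \<subseteq> S" for T and f :: "'m \<Rightarrow> 'k"
    using that
  proof (induction T)
    case (insert m T)
    have k: "Poly_Mapping.keys (Poly_Mapping.single m (f m)) \<subseteq> S" using insert by simp
    from insert k assms(3)[of m "f m"] show ?case
      by (auto intro!: assms(4) dest!: Poly_Mapping.keys_add[THEN subsetD])
  qed (use assms in auto)
  moreover have "p = (\<Sum>m\<in>Poly_Mapping.keys p. Poly_Mapping.single m (Poly_Mapping.lookup p m))"
    by (rule poly_mapping_eqI)
       (auto simp: lookup_sum lookup_single when_def in_keys_iff)
  ultimately show ?thesis using assms(1) by (metis finite_keys)
qed

section \<open>The monoid algebra\<close>

lemma carrier_monoid_algebra: "p \<in> carrier (monoid_algebra M) \<longleftrightarrow> Poly_Mapping.keys p \<subseteq> carrier M"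
  and add_monoid_algebra: "p \<oplus>\<^bsub>monoid_algebra M\<^esub> q = p + q"
  and zero_monoid_algebra: "\<zero>\<^bsub>monoid_algebra M\<^esub> = 0"
  and one_monoid_algebra: "\<one>\<^bsub>monoid_algebra M\<^esub> = Poly_Mapping.single \<one>\<^bsub>M\<^esub> 1"
  and smult_monoid_algebra: "c \<odot>\<^bsub>monoid_algebra M\<^esub> p = scale c p"
  by (simp_all add: monoid_algebra_def)

lemma mult_monoid_algebra: "p \<otimes>\<^bsub>monoid_algebra M\<^esub> q =
   extend (\<lambda>m a. extend (\<lambda>n b. Poly_Mapping.single (m \<otimes>\<^bsub>M\<^esub> n) (a * b)) q) p"
  by (simp add: monoid_algebra_def extend_def)

lemmas monoid_algebra_simps = carrier_monoid_algebra add_monoid_algebra zero_monoid_algebra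
  one_monoid_algebra smult_monoid_algebra

context
  fixes M :: "('m, 'x) monoid_scheme"
begin

private abbreviation kM :: "('k::field, 'm \<Rightarrow>\<^sub>0 'k) module" where "kM \<equiv> monoid_algebra M"

lemma monoid_algebra_mult_add_right: "p \<otimes>\<^bsub>kM\<^esub> (q + r) = p \<otimes>\<^bsub>kM\<^esub> q + p \<otimes>\<^bsub>kM\<^esub> r"
  unfolding mult_monoid_algebra
  by (subst extend_add) (simp_all add: distrib_left single_add extend_fun_add)

lemma monoid_algebra_mult_add_left: "(p + q) \<otimes>\<^bsub>kM\<^esub> r = p \<otimes>\<^bsub>kM\<^esub> r + q \<otimes>\<^bsub>kM\<^esub> r"
  unfolding mult_monoid_algebra
  by (rule extend_add) (simp add: distrib_right single_add extend_fun_add)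

lemma monoid_algebra_mult_zero: "0 \<otimes>\<^bsub>kM\<^esub> p = 0" "p \<otimes>\<^bsub>kM\<^esub> 0 = 0"
  unfolding mult_monoid_algebra by (simp_all add: extend_def)

lemma monoid_algebra_mult_single:
  "Poly_Mapping.single m a \<otimes>\<^bsub>kM\<^esub> Poly_Mapping.single n b = Poly_Mapping.single (m \<otimes>\<^bsub>M\<^esub> n) (a * b)"
  unfolding mult_monoid_algebra by (simp add: extend_single extend_def)

lemma monoid_algebra_mult_diff_right: "p \<otimes>\<^bsub>kM\<^esub> (q - r) = p \<otimes>\<^bsub>kM\<^esub> q - p \<otimes>\<^bsub>kM\<^esub> r"
  using monoid_algebra_mult_add_right[of p "q - r" r] by (simp add: algebra_simps)

lemma monoid_algebra_mult_diff_left: "(p - q) \<otimes>\<^bsub>kM\<^esub> r = p \<otimes>\<^bsub>kM\<^esub> r - q \<otimes>\<^bsub>kM\<^esub> r"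
  using monoid_algebra_mult_add_left[of "p - q" q r] by (simp add: algebra_simps)

lemma scale_carrier: "p \<in> carrier kM \<Longrightarrow> scale c p \<in> carrier kM"
  by (auto simp: carrier_monoid_algebra in_keys_iff lookup_scale subset_iff)

lemma add_carrier: "p \<in> carrier kM \<Longrightarrow> q \<in> carrier kM \<Longrightarrow> p + q \<in> carrier kM"
  by (auto simp: carrier_monoid_algebra dest!: Poly_Mapping.keys_add[THEN subsetD])

lemma uminus_carrier: "p \<in> carrier kM \<Longrightarrow> - p \<in> carrier kM"
  using scale_carrier[of p "-1"] by (simp add: scale_minus_one)

lemma diff_carrier: "p \<in> carrier kM \<Longrightarrow> q \<in> carrier kM \<Longrightarrow> p - q \<in> carrier kM"
  using add_carrier[of p "- q"] uminus_carrier[of q] by simp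

lemma single_carrier: "m \<in> carrier M \<Longrightarrow> Poly_Mapping.single m c \<in> carrier kM"
  by (simp add: carrier_monoid_algebra)

lemma zero_carrier: "0 \<in> carrier kM"
  by (simp add: carrier_monoid_algebra)

lemma abelian_group_monoid_algebra: "abelian_group kM"
proof (rule abelian_groupI)
  show "\<exists>y\<in>carrier kM. y \<oplus>\<^bsub>kM\<^esub> x = \<zero>\<^bsub>kM\<^esub>" if "x \<in> carrier kM" for x :: "'m \<Rightarrow>\<^sub>0 'k::field"
    using uminus_carrier[OF that] by (intro bexI[of _ "- x"]) (simp_all add: monoid_algebra_simps)
qed (simp_all add: add_monoid_algebra zero_monoid_algebra add_carrier zero_carrier algebra_simps)

lemma a_inv_monoid_algebra: "p \<in> carrier kM \<Longrightarrow> \<ominus>\<^bsub>kM\<^esub> p = - p"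
  using abelian_group.minus_equality[OF abelian_group_monoid_algebra, of "- p" p] uminus_carrier[of p]
  by (simp add: monoid_algebra_simps)

lemma cring_scalars: "cring (scalars :: 'k::field ring)"
proof (rule cringI)
  show "abelian_group (scalars :: 'k ring)"
    by (rule abelian_groupI) (auto simp: scalars_def algebra_simps intro: exI[of _ "- x" for x])
  show "comm_monoid (scalars :: 'k ring)"
    by (rule comm_monoidI) (auto simp: scalars_def algebra_simps)
qed (simp add: scalars_def algebra_simps)

lemma module_monoid_algebra: "module scalars kM"
  by (rule moduleI[OF cring_scalars abelian_group_monoid_algebra])
    (auto simp: scalars_def smult_monoid_algebra add_monoid_algebra scale_carrier scale_add scale_left_add scale_scale scale_one)

text \<open>
  Negatives come for free, as multiples by \<open>-1\<close>.
\<close>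

lemma submodule_monoid_algebraI:
  assumes "H \<subseteq> carrier kM" "0 \<in> H" "\<And>p q. p \<in> H \<Longrightarrow> q \<in> H \<Longrightarrow> p + q \<in> H" "\<And>c p. p \<in> H \<Longrightarrow> scale c p \<in> H"
  shows "submodule H scalars kM"
proof (rule module.submoduleI[OF module_monoid_algebra])
  fix p assume "p \<in> H" then show "\<ominus>\<^bsub>kM\<^esub> p \<in> H"
    using assms(4)[of p "-1"] assms(1) by (simp add: a_inv_monoid_algebra scale_minus_one subset_iff)
qed (use assms in \<open>simp_all add: monoid_algebra_simps\<close>)

lemma submodule_monoid_algebraD:
  assumes "submodule H scalars kM"
  shows "H \<subseteq> carrier kM" "0 \<in> H" "\<And>p q. p \<in> H \<Longrightarrow> q \<in> H \<Longrightarrow> p + q \<in> H" "\<And>c p. p \<in> H \<Longrightarrow> scale c p \<in> H"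
     "\<And>p. p \<in> H \<Longrightarrow> - p \<in> H" "\<And>p q. p \<in> H \<Longrightarrow> q \<in> H \<Longrightarrow> p - q \<in> H"
proof -
  note E = module.submoduleE[OF module_monoid_algebra assms]
  show 1: "H \<subseteq> carrier kM" by (rule E)
  show 2: "p + q \<in> H" if "p \<in> H" "q \<in> H" for p q using E(5)[OF that] by (simp add: add_monoid_algebra)
  show 3: "scale c p \<in> H" if "p \<in> H" for c p using E(4)[of c p] that by (simp add: smult_monoid_algebra scalars_def)
  show 4: "- p \<in> H" if "p \<in> H" for p using 3[OF that, of "-1"] by (simp add: scale_minus_one)
  show "p - q \<in> H" if "p \<in> H" "q \<in> H" for p q using 2[OF that(1) 4[OF that(2)]] by simp
  obtain p where "p \<in> H" using E(2) by blast
  then show "0 \<in> H" using 3[of p 0] by (simp add: scale_zero)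
qed

lemma mult_carrier:
  assumes "monoid M" "p \<in> carrier kM" "q \<in> carrier kM"
  shows "p \<otimes>\<^bsub>kM\<^esub> q \<in> carrier kM"
  using assms(2)[unfolded carrier_monoid_algebra]
proof (induction p rule: keys_subset_induct)
  case (single m a)
  from assms(3)[unfolded carrier_monoid_algebra] show ?case
  proof (induction q rule: keys_subset_induct)
    case (single n b)
    with \<open>m \<in> carrier M\<close> show ?case
      by (simp add: monoid_algebra_mult_single single_carrier monoid.m_closed[OF assms(1)])
  qed (simp_all add: monoid_algebra_mult_add_right monoid_algebra_mult_zero add_carrier zero_carrier)
qed (simp_all add: monoid_algebra_mult_add_left monoid_algebra_mult_zero add_carrier zero_carrier)

lemma ring_monoid_algebra:
  assumes "monoid M"
  shows "ring kM"
proof (rule ringI)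
  show "abelian_group kM" by (rule abelian_group_monoid_algebra)
  show "monoid kM"
  proof (rule monoidI)
    fix p q r :: "'m \<Rightarrow>\<^sub>0 'k::field" assume pqr: "p \<in> carrier kM" "q \<in> carrier kM" "r \<in> carrier kM"
    from pqr(1)[unfolded carrier_monoid_algebra] show "p \<otimes>\<^bsub>kM\<^esub> q \<otimes>\<^bsub>kM\<^esub> r = p \<otimes>\<^bsub>kM\<^esub> (q \<otimes>\<^bsub>kM\<^esub> r)"
    proof (induction p rule: keys_subset_induct)
      case (single m a)
      from pqr(2)[unfolded carrier_monoid_algebra] show ?case
      proof (induction q rule: keys_subset_induct)
        case (single n b)
        from pqr(3)[unfolded carrier_monoid_algebra] show ?case
        proof (induction r rule: keys_subset_induct)
          case (single l c)
          with \<open>m \<in> carrier M\<close> \<open>n \<in> carrier M\<close> show ?case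
            by (simp add: monoid_algebra_mult_single monoid.m_assoc[OF assms] mult.assoc)
        qed (simp_all add: monoid_algebra_mult_add_right monoid_algebra_mult_zero)
      qed (simp_all add: monoid_algebra_mult_add_right monoid_algebra_mult_add_left monoid_algebra_mult_zero)
    qed (simp_all add: monoid_algebra_mult_add_left monoid_algebra_mult_zero)
  next
    fix p :: "'m \<Rightarrow>\<^sub>0 'k::field" assume p: "p \<in> carrier kM"
    from p[unfolded carrier_monoid_algebra] show "\<one>\<^bsub>kM\<^esub> \<otimes>\<^bsub>kM\<^esub> p = p"
      by (induction p rule: keys_subset_induct)
        (simp_all add: one_monoid_algebra monoid_algebra_mult_single monoid_algebra_mult_add_right monoid_algebra_mult_zero monoid.l_one[OF assms])
    from p[unfolded carrier_monoid_algebra] show "p \<otimes>\<^bsub>kM\<^esub> \<one>\<^bsub>kM\<^esub> = p"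
      by (induction p rule: keys_subset_induct)
        (simp_all add: one_monoid_algebra monoid_algebra_mult_single monoid_algebra_mult_add_left monoid_algebra_mult_zero monoid.r_one[OF assms])
  qed (simp_all add: mult_carrier[OF assms] one_monoid_algebra single_carrier monoid.one_closed[OF assms])
qed (simp_all add: add_monoid_algebra monoid_algebra_mult_add_left monoid_algebra_mult_add_right)

text \<open>
  Scalars act through multiples of the unit; hence every ideal is a subspace.
\<close>

lemma scale_mult:
  assumes "monoid M" "p \<in> carrier kM"
  shows "scale c p = Poly_Mapping.single \<one>\<^bsub>M\<^esub> c \<otimes>\<^bsub>kM\<^esub> p"
  using assms(2)[unfolded carrier_monoid_algebra]
  by (induction p rule: keys_subset_induct)
    (simp_all add: monoid_algebra_mult_single monoid_algebra_mult_add_right monoid_algebra_mult_zero scale_add scale_zero_right monoid.l_one[OF assms(1)])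

end

section \<open>Quotients\<close>

lemma ideal_imp_submodule:
  fixes M :: "('m, 'x) monoid_scheme" and I :: "('m \<Rightarrow>\<^sub>0 'k::field) set"
  assumes "monoid M" "ideal I (monoid_algebra M :: ('k, 'm \<Rightarrow>\<^sub>0 'k) module)"
  shows "submodule I scalars (monoid_algebra M)"
proof -
  interpret ideal I "monoid_algebra M :: ('k, 'm \<Rightarrow>\<^sub>0 'k) module" by fact
  show ?thesis
  proof (rule submodule_monoid_algebraI)
    show "I \<subseteq> carrier (monoid_algebra M)" by (rule a_subset)
    show "0 \<in> I"
      using additive_subgroup.zero_closed[OF is_additive_subgroup] by (simp only: zero_monoid_algebra)
    show "p + q \<in> I" if "p \<in> I" "q \<in> I" for p q using additive_subgroup.a_closed[OF is_additive_subgroup that] by (simp add: add_monoid_algebra)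
    show "scale c p \<in> I" if "p \<in> I" for c p
      using I_l_closed[OF that single_carrier[OF monoid.one_closed[OF assms(1)], of c]] Icarr[OF that]
      by (simp add: scale_mult[OF assms(1)])
  qed
qed

context
  fixes M :: "('m, 'x) monoid_scheme" and H :: "('m \<Rightarrow>\<^sub>0 'k::field) set"
  assumes H: "submodule H scalars (monoid_algebra M)"
begin

private abbreviation A :: "('k, 'm \<Rightarrow>\<^sub>0 'k) module" where "A \<equiv> monoid_algebra M"
private abbreviation Q where "Q \<equiv> quotient A H"
private abbreviation cl where "cl p \<equiv> H +>\<^bsub>A\<^esub> p"

lemmas H_closed = submodule_monoid_algebraD[OF H]

lemma abelian_subgroup_monoid_algebra: "abelian_subgroup H A"
  by (rule abelian_subgroupI3[OF _ abelian_group_monoid_algebra])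
    (use submodule.axioms(1)[OF H] in \<open>simp add: additive_subgroup_def\<close>)

lemma coset_eq: "cl p = (\<lambda>h. h + p) ` H"
  by (auto simp: a_r_coset_def r_coset_def monoid_algebra_def)

lemma mem_coset_iff: "q \<in> cl p \<longleftrightarrow> q - p \<in> H"
  unfolding coset_eq by (auto simp: image_iff algebra_simps intro: bexI[of _ "q - p"])

lemma coset_self: "p \<in> cl p"
  using H_closed(2) by (simp add: mem_coset_iff)

lemma coset_eq_iff: "cl p = cl q \<longleftrightarrow> p - q \<in> H"
proof
  assume "cl p = cl q" then show "p - q \<in> H" using coset_self[of p] mem_coset_iff by simp
next
  assume pq: "p - q \<in> H"
  have "x - p \<in> H \<longleftrightarrow> x - q \<in> H" for x
    using H_closed(3)[OF _ pq, of "x - p"] H_closed(6)[OF _ pq, of "x - q"] by auto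
  then show "cl p = cl q" by (auto simp: mem_coset_iff)
qed

lemma coset_zero: "cl 0 = H"
  by (simp add: coset_eq)

lemma carrier_quotient: "carrier Q = cl ` carrier A"
  by (auto simp: quotient_def FactRing_def A_RCOSETS_def RCOSETS_def a_r_coset_def)

lemma coset_in_carrier: "p \<in> carrier A \<Longrightarrow> cl p \<in> carrier Q"
  by (simp add: carrier_quotient)

lemma quotient_cases:
  assumes "X \<in> carrier Q"
  obtains p where "p \<in> carrier A" "X = cl p"
  using assms by (auto simp: carrier_quotient)

lemma zero_quotient: "\<zero>\<^bsub>Q\<^esub> = H"
  by (simp add: quotient_def FactRing_def)

lemma one_quotient: "\<one>\<^bsub>Q\<^esub> = cl \<one>\<^bsub>A\<^esub>"
  by (simp add: quotient_def FactRing_def)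

lemma add_quotient:
  assumes "p \<in> carrier A" "q \<in> carrier A"
  shows "cl p \<oplus>\<^bsub>Q\<^esub> cl q = cl (p + q)"
  using abelian_subgroup.a_rcos_sum[OF abelian_subgroup_monoid_algebra assms]
  by (simp add: quotient_def FactRing_def add_monoid_algebra)

lemma smult_quotient: "c \<odot>\<^bsub>Q\<^esub> cl p = cl (scale c p)"
proof -
  have "cl (scale c x) = cl (scale c p)" if "x \<in> cl p" for x
    using that H_closed(4)[of "x - p" c] by (simp add: mem_coset_iff coset_eq_iff scale_diff)
  then have "(\<Union>x\<in>cl p. cl (scale c x)) = cl (scale c p)"
    by (intro UN_constant_eq[OF coset_self] ballI)
  then show ?thesis by (simp add: quotient_def smult_monoid_algebra)
qed

lemma abelian_group_quotient: "abelian_group Q"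
proof (rule abelian_groupI)
  fix X Y assume "X \<in> carrier Q" "Y \<in> carrier Q"
  then obtain p q where "p \<in> carrier A" "X = cl p" "q \<in> carrier A" "Y = cl q"
    by (auto simp: carrier_quotient)
  then show "X \<oplus>\<^bsub>Q\<^esub> Y \<in> carrier Q" "X \<oplus>\<^bsub>Q\<^esub> Y = Y \<oplus>\<^bsub>Q\<^esub> X"
    by (simp_all add: add_quotient coset_in_carrier add_carrier add.commute)
next
  fix X Y Z assume "X \<in> carrier Q" "Y \<in> carrier Q" "Z \<in> carrier Q"
  then obtain p q r where "p \<in> carrier A" "X = cl p" "q \<in> carrier A" "Y = cl q" "r \<in> carrier A" "Z = cl r"
    by (auto simp: carrier_quotient)
  then show "X \<oplus>\<^bsub>Q\<^esub> Y \<oplus>\<^bsub>Q\<^esub> Z = X \<oplus>\<^bsub>Q\<^esub> (Y \<oplus>\<^bsub>Q\<^esub> Z)"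
    by (simp add: add_quotient add_carrier add.assoc)
next
  have z: "\<zero>\<^bsub>Q\<^esub> = cl 0" by (simp add: zero_quotient coset_zero)
  show "\<zero>\<^bsub>Q\<^esub> \<in> carrier Q" by (simp add: z coset_in_carrier zero_carrier)
  fix X assume X: "X \<in> carrier Q"
  then obtain p where p: "p \<in> carrier A" "X = cl p" by (rule quotient_cases)
  then show "\<zero>\<^bsub>Q\<^esub> \<oplus>\<^bsub>Q\<^esub> X = X"
    unfolding z by (simp add: add_quotient zero_carrier)
  from p show "\<exists>Y\<in>carrier Q. Y \<oplus>\<^bsub>Q\<^esub> X = \<zero>\<^bsub>Q\<^esub>"
    unfolding z by (intro bexI[of _ "cl (- p)"]) (simp_all add: add_quotient uminus_carrier coset_in_carrier)
qed

lemma module_quotient: "module scalars Q"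
proof (rule moduleI[OF cring_scalars abelian_group_quotient])
  fix a b X Y assume "X \<in> carrier Q" "Y \<in> carrier Q"
  then obtain p q where "p \<in> carrier A" "X = cl p" "q \<in> carrier A" "Y = cl q"
    by (auto simp: carrier_quotient)
  then show "a \<odot>\<^bsub>Q\<^esub> (X \<oplus>\<^bsub>Q\<^esub> Y) = a \<odot>\<^bsub>Q\<^esub> X \<oplus>\<^bsub>Q\<^esub> a \<odot>\<^bsub>Q\<^esub> Y"
    by (simp add: add_quotient smult_quotient scale_carrier scale_add)
next
  fix a b X assume "X \<in> carrier Q"
  then obtain p where "p \<in> carrier A" "X = cl p" by (rule quotient_cases)
  then show "a \<odot>\<^bsub>Q\<^esub> X \<in> carrier Q"
    "(a \<oplus>\<^bsub>scalars\<^esub> b) \<odot>\<^bsub>Q\<^esub> X = a \<odot>\<^bsub>Q\<^esub> X \<oplus>\<^bsub>Q\<^esub> b \<odot>\<^bsub>Q\<^esub> X"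
    "(a \<otimes>\<^bsub>scalars\<^esub> b) \<odot>\<^bsub>Q\<^esub> X = a \<odot>\<^bsub>Q\<^esub> (b \<odot>\<^bsub>Q\<^esub> X)"
    "\<one>\<^bsub>scalars\<^esub> \<odot>\<^bsub>Q\<^esub> X = X"
    by (simp_all add: scalars_def add_quotient smult_quotient coset_in_carrier scale_carrier
        scale_left_add scale_scale scale_one)
qed

lemma a_inv_quotient: "p \<in> carrier A \<Longrightarrow> \<ominus>\<^bsub>Q\<^esub> cl p = cl (- p)"
proof (rule abelian_group.minus_equality[OF abelian_group_quotient])
  assume p: "p \<in> carrier A"
  then show "cl (- p) \<oplus>\<^bsub>Q\<^esub> cl p = \<zero>\<^bsub>Q\<^esub>"
    by (simp add: add_quotient uminus_carrier zero_quotient coset_zero)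
  show "cl p \<in> carrier Q" "cl (- p) \<in> carrier Q"
    using p by (simp_all add: uminus_carrier coset_in_carrier)
qed

text \<open>
  The sums that define \<^const>\<open>tensor_lift\<close> are formed in the quotient; this lemma brings them down to
  representatives.
\<close>

lemma finsum_quotient:
  assumes "finite S" "\<And>s. s \<in> S \<Longrightarrow> f s \<in> carrier A"
  shows "(\<Oplus>\<^bsub>Q\<^esub>s\<in>S. cl (f s)) = cl (\<Sum>s\<in>S. f s) \<and> (\<Sum>s\<in>S. f s) \<in> carrier A"
  using assms
proof (induction S)
  case empty
  show ?case
    by (simp add: abelian_monoid.finsum_empty[OF abelian_group.axioms(1)[OF abelian_group_quotient]]
        zero_quotient coset_zero zero_carrier)
next
  case (insert s S)
  then have IH: "(\<Oplus>\<^bsub>Q\<^esub>s\<in>S. cl (f s)) = cl (\<Sum>s\<in>S. f s)" "(\<Sum>s\<in>S. f s) \<in> carrier A" "f s \<in> carrier A"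
    by simp_all
  have "(\<Oplus>\<^bsub>Q\<^esub>s\<in>insert s S. cl (f s)) = cl (f s) \<oplus>\<^bsub>Q\<^esub> (\<Oplus>\<^bsub>Q\<^esub>s\<in>S. cl (f s))"
    by (rule abelian_monoid.finsum_insert[OF abelian_group.axioms(1)[OF abelian_group_quotient]])
      (use insert in \<open>auto intro!: coset_in_carrier\<close>)
  then show ?case using insert(1,2) by (simp add: IH add_quotient add_carrier)
qed

context
  assumes M: "monoid M" and ideal: "ideal H A"
begin

lemma mult_quotient:
  assumes "p \<in> carrier A" "q \<in> carrier A"
  shows "cl p \<otimes>\<^bsub>Q\<^esub> cl q = cl (p \<otimes>\<^bsub>A\<^esub> q)"
  using ideal.rcoset_mult_add[OF ideal assms] by (simp add: quotient_def FactRing_def)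

lemma ring_quotient: "ring Q"
proof (rule ringI)
  show "abelian_group Q" by (rule abelian_group_quotient)
  interpret R: ring A by (rule ring_monoid_algebra[OF M])
  show "monoid Q"
  proof (rule monoidI)
    fix X Y Z assume "X \<in> carrier Q" "Y \<in> carrier Q" "Z \<in> carrier Q"
    then obtain p q r where "p \<in> carrier A" "X = cl p" "q \<in> carrier A" "Y = cl q" "r \<in> carrier A" "Z = cl r"
      by (auto simp: carrier_quotient)
    then show "X \<otimes>\<^bsub>Q\<^esub> Y \<in> carrier Q" "X \<otimes>\<^bsub>Q\<^esub> Y \<otimes>\<^bsub>Q\<^esub> Z = X \<otimes>\<^bsub>Q\<^esub> (Y \<otimes>\<^bsub>Q\<^esub> Z)"
      "\<one>\<^bsub>Q\<^esub> \<otimes>\<^bsub>Q\<^esub> X = X" "X \<otimes>\<^bsub>Q\<^esub> \<one>\<^bsub>Q\<^esub> = X"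
      by (simp_all add: mult_quotient one_quotient coset_in_carrier R.m_assoc)
  qed (simp add: one_quotient coset_in_carrier)
  fix X Y Z assume "X \<in> carrier Q" "Y \<in> carrier Q" "Z \<in> carrier Q"
  then obtain p q r where "p \<in> carrier A" "X = cl p" "q \<in> carrier A" "Y = cl q" "r \<in> carrier A" "Z = cl r"
    by (auto simp: carrier_quotient)
  then show "(X \<oplus>\<^bsub>Q\<^esub> Y) \<otimes>\<^bsub>Q\<^esub> Z = X \<otimes>\<^bsub>Q\<^esub> Z \<oplus>\<^bsub>Q\<^esub> Y \<otimes>\<^bsub>Q\<^esub> Z"
    "Z \<otimes>\<^bsub>Q\<^esub> (X \<oplus>\<^bsub>Q\<^esub> Y) = Z \<otimes>\<^bsub>Q\<^esub> X \<oplus>\<^bsub>Q\<^esub> Z \<otimes>\<^bsub>Q\<^esub> Y"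
    by (simp_all add: mult_quotient add_quotient add_carrier mult_carrier[OF M]
      monoid_algebra_mult_add_left monoid_algebra_mult_add_right)
qed

text \<open>
  The difference in a \<^const>\<open>commutator\<close> is taken with the inverse that the group structure of the quotient
  provides, which is meaningful only because products of cosets are again cosets.
\<close>

lemma commutator_quotient:
  assumes "p \<in> carrier A" "q \<in> carrier A"
  shows "commutator Q (cl p) (cl q) = cl (p \<otimes>\<^bsub>A\<^esub> q - q \<otimes>\<^bsub>A\<^esub> p)"
proof -
  have "p \<otimes>\<^bsub>A\<^esub> q \<in> carrier A" "q \<otimes>\<^bsub>A\<^esub> p \<in> carrier A" using assms by (simp_all add: mult_carrier[OF M])
  with assms show ?thesis
    by (simp add: commutator_def a_minus_def mult_quotient a_inv_quotient add_quotient uminus_carrier)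
qed

end

end

section \<open>Tensor products\<close>

context
  fixes V :: "('k::field, 'v, 'x) module_scheme" and W :: "('k, 'w, 'y) module_scheme"
  assumes V: "module scalars V" and W: "module scalars W"
begin

private abbreviation kVW :: "('k, 'v \<times> 'w \<Rightarrow>\<^sub>0 'k) module" where "kVW \<equiv> monoid_algebra (V \<times>\<times> W)"

lemma tensor_relations_carrier: "tensor_relations V W \<subseteq> carrier kVW"
proof -
  interpret V: module scalars V by (rule V)
  interpret W: module scalars W by (rule W)
  have s: "Poly_Mapping.single (x, y) c \<in> carrier kVW" if "x \<in> carrier V" "y \<in> carrier W" for x y c
    using that by (simp add: single_carrier)
  have "c \<odot>\<^bsub>V\<^esub> x \<in> carrier V" if "x \<in> carrier V" for c x
    using V.smult_closed[of c x] that by (simp add: scalars_def)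
  moreover have "c \<odot>\<^bsub>W\<^esub> x \<in> carrier W" if "x \<in> carrier W" for c x
    using W.smult_closed[of c x] that by (simp add: scalars_def)
  ultimately show ?thesis
    unfolding tensor_relations_def by (auto intro!: diff_carrier s)
qed

lemma linear_span_submodule:
  assumes "S \<subseteq> carrier kVW"
  shows "submodule (linear_span kVW S) scalars kVW"
proof -
  have c: "submodule (carrier kVW) scalars kVW"
    by (rule module.carrier_is_submodule[OF module_monoid_algebra])
  show ?thesis
    unfolding linear_span_def
    by (rule submodule_monoid_algebraI)
      (use c assms in \<open>blast intro: submodule_monoid_algebraD(2-4)\<close>)+
qed

lemma tensor_kernel_submodule: "submodule (tensor_kernel V W) scalars kVW"
  unfolding tensor_kernel_def by (rule linear_span_submodule[OF tensor_relations_carrier])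

lemma tensor_relations_subset: "tensor_relations V W \<subseteq> tensor_kernel V W"
  unfolding tensor_kernel_def linear_span_def by blast

text \<open>
  Every subspace that contains the bilinearity relations contains the kernel. All maps out of a tensor product
  are shown to be well defined with it.
\<close>

lemma tensor_kernel_minimal:
  "submodule H scalars kVW \<Longrightarrow> tensor_relations V W \<subseteq> H \<Longrightarrow> tensor_kernel V W \<subseteq> H"
  unfolding tensor_kernel_def linear_span_def by blast

lemmas module_tensor = module_quotient[OF tensor_kernel_submodule, folded tensor_def]

lemma pure_tensor_carrier: "x \<in> carrier V \<Longrightarrow> y \<in> carrier W \<Longrightarrow> pure_tensor V W x y \<in> carrier (tensor V W)"
  unfolding pure_tensor_def tensor_def
  by (rule coset_in_carrier[OF tensor_kernel_submodule]) (simp add: single_carrier)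

lemma tensor_cases:
  assumes "T \<in> carrier (tensor V W)"
  obtains p where "p \<in> carrier kVW" "T = tensor_kernel V W +>\<^bsub>kVW\<^esub> p"
  using assms unfolding tensor_def by (rule quotient_cases[OF tensor_kernel_submodule])

end

text \<open>
  The map of formal sums induced by a map \<open>g\<close> of the bases.
\<close>

definition pushforward :: "('a \<Rightarrow> 'b) \<Rightarrow> ('a \<Rightarrow>\<^sub>0 'k::field) \<Rightarrow> ('b \<Rightarrow>\<^sub>0 'k)" where
  "pushforward g = extend (\<lambda>m a. Poly_Mapping.single (g m) a)"

lemma pushforward_add: "pushforward g (p + q) = pushforward g p + pushforward g q"
  unfolding pushforward_def by (rule extend_add) (simp add: single_add)

lemma pushforward_diff: "pushforward g (p - q) = pushforward g p - pushforward g q"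
  unfolding pushforward_def by (rule extend_diff) (simp add: single_add)

lemma pushforward_single: "pushforward g (Poly_Mapping.single m a) = Poly_Mapping.single (g m) a"
  unfolding pushforward_def by (rule extend_single) simp

lemma pushforward_zero: "pushforward g 0 = 0"
  by (simp add: pushforward_def)

lemma pushforward_scale: "pushforward g (scale c p) = scale c (pushforward g p)"
  by (induction p rule: keys_subset_induct[OF subset_UNIV])
    (simp_all add: pushforward_zero pushforward_single pushforward_add scale_add scale_zero_right)

lemma pushforward_carrier:
  assumes "\<And>m. m \<in> carrier M \<Longrightarrow> g m \<in> carrier N" "p \<in> carrier (monoid_algebra M)"
  shows "pushforward g p \<in> carrier (monoid_algebra N)"
  using assms(2)[unfolded carrier_monoid_algebra]
  by (induction p rule: keys_subset_induct)
    (simp_all add: pushforward_zero pushforward_single pushforward_add zero_carrier single_carrier add_carrier assms)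

text \<open>
  On representatives \<open>f \<otimes> g\<close> replaces each pair \<open>(x, y)\<close> by \<open>(f x, g y)\<close>. The class of the result does
  not depend on the representative, because \<open>f\<close> and \<open>g\<close> carry relations to relations.
\<close>

lemma tensor_map_coset:
  fixes V :: "('k::field, 'v, 'x) module_scheme" and W :: "('k, 'w, 'y) module_scheme"
    and V' :: "('k, 'v', 'x') module_scheme" and W' :: "('k, 'w', 'y') module_scheme"
  assumes mod: "module scalars V" "module scalars W" "module scalars V'" "module scalars W'"
    and f: "f \<in> linear_maps V V'" and g: "g \<in> linear_maps W W'"
    and p: "p \<in> carrier (monoid_algebra (V \<times>\<times> W))"
  defines "h \<equiv> \<lambda>(x, y). (f x, g y)"
  shows "tensor_map V' W' f g (tensor_kernel V W +>\<^bsub>(monoid_algebra (V \<times>\<times> W) :: ('k, 'v \<times> 'w \<Rightarrow>\<^sub>0 'k) module)\<^esub> p)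
    = tensor_kernel V' W' +>\<^bsub>monoid_algebra (V' \<times>\<times> W')\<^esub> pushforward h p"
proof -
  let ?A = "monoid_algebra (V \<times>\<times> W) :: ('k, 'v \<times> 'w \<Rightarrow>\<^sub>0 'k) module"
  let ?B = "monoid_algebra (V' \<times>\<times> W') :: ('k, 'v' \<times> 'w' \<Rightarrow>\<^sub>0 'k) module"
  let ?K = "tensor_kernel V W" and ?K' = "tensor_kernel V' W'"
  note K = tensor_kernel_submodule[OF mod(1,2)] and K' = tensor_kernel_submodule[OF mod(3,4)]
  note KD = submodule_monoid_algebraD[OF K] and KD' = submodule_monoid_algebraD[OF K']
  have fg: "f x \<in> carrier V'" "f (x \<oplus>\<^bsub>V\<^esub> x') = f x \<oplus>\<^bsub>V'\<^esub> f x'" "f (c \<odot>\<^bsub>V\<^esub> x) = c \<odot>\<^bsub>V'\<^esub> f x"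
    if "x \<in> carrier V" "x' \<in> carrier V" for c x x'
    using f that by (auto simp: linear_maps_def)
  have gg: "g x \<in> carrier W'" "g (x \<oplus>\<^bsub>W\<^esub> x') = g x \<oplus>\<^bsub>W'\<^esub> g x'" "g (c \<odot>\<^bsub>W\<^esub> x) = c \<odot>\<^bsub>W'\<^esub> g x"
    if "x \<in> carrier W" "x' \<in> carrier W" for c x x'
    using g that by (auto simp: linear_maps_def)
  have hc: "h m \<in> carrier (V' \<times>\<times> W')" if "m \<in> carrier (V \<times>\<times> W)" for m
    using that fg gg by (auto simp: h_def)
  have rel: "pushforward h r \<in> ?K'" if "r \<in> tensor_relations V W" for r
    using that unfolding tensor_relations_def
    by (intro subsetD[OF tensor_relations_subset[OF mod(3,4)]], unfold tensor_relations_def)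
       (elim UnE CollectE exE conjE; simp add: pushforward_diff pushforward_single h_def fg gg; blast intro: fg gg)
  have "submodule {q \<in> carrier ?A. pushforward h q \<in> ?K'} scalars ?A"
    by (rule submodule_monoid_algebraI)
      (auto simp: pushforward_add pushforward_scale pushforward_zero add_carrier scale_carrier zero_carrier KD')
  then have ker: "pushforward h q \<in> ?K'" if "q \<in> ?K" for q
    using tensor_kernel_minimal[OF mod(1,2), of "{q \<in> carrier ?A. pushforward h q \<in> ?K'}"] that rel
      tensor_relations_carrier[OF mod(1,2)] by blast
  have sum: "(\<Oplus>\<^bsub>tensor V' W'\<^esub>k\<in>Poly_Mapping.keys q. Poly_Mapping.lookup q k \<odot>\<^bsub>tensor V' W'\<^esub>
      pure_tensor V' W' (f (fst k)) (g (snd k))) = ?K' +>\<^bsub>?B\<^esub> pushforward h p" if "q \<in> ?K +>\<^bsub>?A\<^esub> p" for q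
  proof -
    have d: "q - p \<in> ?K" using that by (simp add: mem_coset_iff[OF K])
    then have "q - p \<in> carrier ?A" using KD(1) by blast
    then have q: "q \<in> carrier ?A" using add_carrier[OF _ p, of "q - p"] by simp
    have "(\<Oplus>\<^bsub>tensor V' W'\<^esub>k\<in>Poly_Mapping.keys q. Poly_Mapping.lookup q k \<odot>\<^bsub>tensor V' W'\<^esub>
      pure_tensor V' W' (f (fst k)) (g (snd k))) = 
      (\<Oplus>\<^bsub>tensor V' W'\<^esub>k\<in>Poly_Mapping.keys q. ?K' +>\<^bsub>?B\<^esub> Poly_Mapping.single (h k) (Poly_Mapping.lookup q k))"
      unfolding pure_tensor_def tensor_def smult_quotient[OF K'] by (simp add: h_def case_prod_beta)
    also have "\<dots> = ?K' +>\<^bsub>?B\<^esub> (\<Sum>k\<in>Poly_Mapping.keys q. Poly_Mapping.single (h k) (Poly_Mapping.lookup q k))"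
      unfolding tensor_def using q
      by (intro conjunct1[OF finsum_quotient[OF K']]) (auto simp: carrier_monoid_algebra intro!: single_carrier hc simp del: carrier_DirProd)
    also have "\<dots> = ?K' +>\<^bsub>?B\<^esub> pushforward h q" by (simp add: pushforward_def extend_def)
    also have "\<dots> = ?K' +>\<^bsub>?B\<^esub> pushforward h p"
      using ker[OF d] by (simp add: coset_eq_iff[OF K'] pushforward_diff)
    finally show ?thesis .
  qed
  have "(\<lambda>q. \<Oplus>\<^bsub>tensor V' W'\<^esub>k\<in>Poly_Mapping.keys q. Poly_Mapping.lookup q k \<odot>\<^bsub>tensor V' W'\<^esub>
      pure_tensor V' W' (f (fst k)) (g (snd k))) ` (?K +>\<^bsub>?A\<^esub> p) = {?K' +>\<^bsub>?B\<^esub> pushforward h p}"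
    using sum coset_self[OF K, of p] by (auto simp: image_iff)
  then show ?thesis
    unfolding tensor_map_def tensor_lift_def by simp
qed

text \<open>
  Unital associative algebras, commutative or not.
\<close>

definition assoc_algebra :: "('k::field, 'v, 'x) module_scheme \<Rightarrow> bool" where
  "assoc_algebra V \<longleftrightarrow> ring V \<and> module scalars V \<and>
     (\<forall>c. \<forall>x\<in>carrier V. \<forall>y\<in>carrier V. (c \<odot>\<^bsub>V\<^esub> x) \<otimes>\<^bsub>V\<^esub> y = c \<odot>\<^bsub>V\<^esub> (x \<otimes>\<^bsub>V\<^esub> y)
        \<and> x \<otimes>\<^bsub>V\<^esub> (c \<odot>\<^bsub>V\<^esub> y) = c \<odot>\<^bsub>V\<^esub> (x \<otimes>\<^bsub>V\<^esub> y))"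

lemma mult_scale:
  assumes "monoid M" "p \<in> carrier (monoid_algebra M)" "q \<in> carrier (monoid_algebra M)"
  shows "scale c p \<otimes>\<^bsub>monoid_algebra M\<^esub> q = scale c (p \<otimes>\<^bsub>monoid_algebra M\<^esub> q)"
    "p \<otimes>\<^bsub>monoid_algebra M\<^esub> scale c q = scale c (p \<otimes>\<^bsub>monoid_algebra M\<^esub> q)"
  using assms(2)[unfolded carrier_monoid_algebra]
proof (induction p rule: keys_subset_induct)
  case (single m a)
  { case 1 from assms(3)[unfolded carrier_monoid_algebra] show ?case
      by (induction q rule: keys_subset_induct)
        (simp_all add: monoid_algebra_mult_single monoid_algebra_mult_zero monoid_algebra_mult_add_right scale_add scale_zero_right mult.assoc)
  next
    case 2 from assms(3)[unfolded carrier_monoid_algebra] show ?case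
      by (induction q rule: keys_subset_induct)
        (simp_all add: monoid_algebra_mult_single monoid_algebra_mult_zero monoid_algebra_mult_add_right scale_add scale_zero_right mult.left_commute)
  }
qed (simp_all add: monoid_algebra_mult_zero monoid_algebra_mult_add_left scale_add scale_zero_right)

lemma assoc_algebra_quotient:
  fixes I :: "('m \<Rightarrow>\<^sub>0 'k::field) set"
  assumes M: "monoid M" and I: "ideal I (monoid_algebra M)"
  shows "assoc_algebra (quotient (monoid_algebra M) I)"
proof -
  note s = ideal_imp_submodule[OF M I]
  show ?thesis
    unfolding assoc_algebra_def
  proof (intro conjI allI ballI ring_quotient[OF s M I] module_quotient[OF s])
    fix c :: 'k and X Y assume "X \<in> carrier (quotient (monoid_algebra M) I)" "Y \<in> carrier (quotient (monoid_algebra M) I)"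
    then obtain p q where "p \<in> carrier (monoid_algebra M)" "X = I +>\<^bsub>monoid_algebra M\<^esub> p"
      "q \<in> carrier (monoid_algebra M)" "Y = I +>\<^bsub>monoid_algebra M\<^esub> q"
      by (auto simp: carrier_quotient[OF s])
    then show "(c \<odot>\<^bsub>quotient (monoid_algebra M) I\<^esub> X) \<otimes>\<^bsub>quotient (monoid_algebra M) I\<^esub> Y =
       c \<odot>\<^bsub>quotient (monoid_algebra M) I\<^esub> (X \<otimes>\<^bsub>quotient (monoid_algebra M) I\<^esub> Y)"
      "X \<otimes>\<^bsub>quotient (monoid_algebra M) I\<^esub> (c \<odot>\<^bsub>quotient (monoid_algebra M) I\<^esub> Y) =
       c \<odot>\<^bsub>quotient (monoid_algebra M) I\<^esub> (X \<otimes>\<^bsub>quotient (monoid_algebra M) I\<^esub> Y)"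
      by (simp_all add: mult_quotient[OF s M I] smult_quotient[OF s] scale_carrier mult_scale[OF M])
  qed
qed

text \<open>
  A relation multiplied by a pair \<open>(u, w)\<close> is again a relation, since left and right multiplications in \<open>V\<close>
  and \<open>W\<close> are linear.
\<close>

lemma tensor_kernel_ideal:
  fixes V :: "('k::field, 'v, 'x) module_scheme" and W :: "('k, 'w, 'y) module_scheme"
  assumes V: "assoc_algebra V" and W: "assoc_algebra W"
  shows "ideal (tensor_kernel V W) (monoid_algebra (V \<times>\<times> W))"
proof -
  interpret V: ring V using V by (simp add: assoc_algebra_def)
  interpret W: ring W using W by (simp add: assoc_algebra_def)
  have mod: "module scalars V" "module scalars W" using V W by (simp_all add: assoc_algebra_def)
  have sV: "(c \<odot>\<^bsub>V\<^esub> x) \<otimes>\<^bsub>V\<^esub> y = c \<odot>\<^bsub>V\<^esub> (x \<otimes>\<^bsub>V\<^esub> y)" "x \<otimes>\<^bsub>V\<^esub> (c \<odot>\<^bsub>V\<^esub> y) = c \<odot>\<^bsub>V\<^esub> (x \<otimes>\<^bsub>V\<^esub> y)"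
    if "x \<in> carrier V" "y \<in> carrier V" for c x y using V that by (simp_all add: assoc_algebra_def)
  have sW: "(c \<odot>\<^bsub>W\<^esub> x) \<otimes>\<^bsub>W\<^esub> y = c \<odot>\<^bsub>W\<^esub> (x \<otimes>\<^bsub>W\<^esub> y)" "x \<otimes>\<^bsub>W\<^esub> (c \<odot>\<^bsub>W\<^esub> y) = c \<odot>\<^bsub>W\<^esub> (x \<otimes>\<^bsub>W\<^esub> y)"
    if "x \<in> carrier W" "y \<in> carrier W" for c x y using W that by (simp_all add: assoc_algebra_def)
  have M: "monoid (V \<times>\<times> W)" by (rule DirProd_monoid[OF V.is_monoid W.is_monoid])
  let ?A = "monoid_algebra (V \<times>\<times> W) :: ('k, 'v \<times> 'w \<Rightarrow>\<^sub>0 'k) module"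
  let ?K = "tensor_kernel V W"
  note K = tensor_kernel_submodule[OF mod]
  note KD = submodule_monoid_algebraD[OF K]
  have rel: "Poly_Mapping.single (u, w) 1 \<otimes>\<^bsub>?A\<^esub> r \<in> tensor_relations V W \<and>
     r \<otimes>\<^bsub>?A\<^esub> Poly_Mapping.single (u, w) 1 \<in> tensor_relations V W"
    if "r \<in> tensor_relations V W" "u \<in> carrier V" "w \<in> carrier W" for r u w
    using that unfolding tensor_relations_def
    by (elim UnE CollectE exE conjE; simp add: monoid_algebra_mult_diff_left monoid_algebra_mult_diff_right
          monoid_algebra_mult_single V.l_distr V.r_distr W.l_distr W.r_distr sV sW)
       (blast intro: V.m_closed W.m_closed)+
  \<comment> \<open>The elements that stay in the kernel after multiplication by any basis vector.\<close>
  let ?H = "{r \<in> ?K. \<forall>m \<in> carrier (V \<times>\<times> W). Poly_Mapping.single m 1 \<otimes>\<^bsub>?A\<^esub> r \<in> ?K \<and> r \<otimes>\<^bsub>?A\<^esub> Poly_Mapping.single m 1 \<in> ?K}"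
  have "submodule ?H scalars ?A"
  proof (rule submodule_monoid_algebraI)
    fix c p assume p: "p \<in> ?H"
    then have "p \<in> carrier ?A" using KD(1) by blast
    then show "scale c p \<in> ?H" using p
      by (auto simp: KD mult_scale[OF M] single_carrier simp del: carrier_DirProd mult_DirProd')
  qed (use KD in \<open>auto simp: monoid_algebra_mult_add_left monoid_algebra_mult_add_right monoid_algebra_mult_zero simp del: carrier_DirProd\<close>)
  moreover have "tensor_relations V W \<subseteq> ?H"
    using rel tensor_relations_subset[OF mod] by auto
  ultimately have "?K \<subseteq> ?H" by (rule tensor_kernel_minimal[OF mod])
  then have basis: "Poly_Mapping.single m 1 \<otimes>\<^bsub>?A\<^esub> r \<in> ?K" "r \<otimes>\<^bsub>?A\<^esub> Poly_Mapping.single m 1 \<in> ?K"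
    if "r \<in> ?K" "m \<in> carrier (V \<times>\<times> W)" for r m using that by auto
  have "q \<otimes>\<^bsub>?A\<^esub> r \<in> ?K \<and> r \<otimes>\<^bsub>?A\<^esub> q \<in> ?K" if r: "r \<in> ?K" and q: "q \<in> carrier ?A" for q r
    using q[unfolded carrier_monoid_algebra]
  proof (induction q rule: keys_subset_induct)
    case (single m a)
    have "Poly_Mapping.single m a = scale a (Poly_Mapping.single m 1)" by simp
    moreover have "r \<in> carrier ?A" using KD(1) r by blast
    ultimately show ?case
      using basis[OF r single] KD(4) mult_scale[OF M single_carrier[OF single]] mult_scale[OF M _ single_carrier[OF single]]
      by metis
  qed (use KD in \<open>auto simp: monoid_algebra_mult_add_left monoid_algebra_mult_add_right monoid_algebra_mult_zero\<close>)
  then show ?thesis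
    by (intro idealI ring_monoid_algebra[OF M] submodule.axioms(1)[OF K]) auto
qed

section \<open>Matrix representations\<close>

text \<open>
  The Kronecker product, the matrix of \<open>A \<otimes> B\<close>.
\<close>

definition kron :: "'k::comm_ring_1^'m^'m \<Rightarrow> 'k^'n^'n \<Rightarrow> ('k, 'm \<times> 'n) vec ^ ('m \<times> 'n)" where
  "kron A B = (\<chi> x y. A $ fst x $ fst y * B $ snd x $ snd y)"

lemma kron_mult: "kron A B ** kron C D = kron (A ** C) (B ** D)"
  by (simp add: kron_def matrix_matrix_mult_def vec_eq_iff sum_product sum.cartesian_product case_prod_beta ac_simps
     flip: UNIV_Times_UNIV)

definition matrix_eval :: "('m \<Rightarrow> 'k^'n^'n) \<Rightarrow> ('m \<Rightarrow>\<^sub>0 'k::field) \<Rightarrow> 'k^'n^'n" where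
  "matrix_eval f p = (\<chi> i j. extend (\<lambda>m a. a * f m $ i $ j) p)"

lemma matrix_eval_add: "matrix_eval f (p + q) = matrix_eval f p + matrix_eval f q"
  by (simp add: matrix_eval_def vec_eq_iff extend_add distrib_right)

lemma matrix_eval_diff: "matrix_eval f (p - q) = matrix_eval f p - matrix_eval f q"
  by (simp add: matrix_eval_def vec_eq_iff extend_diff distrib_right)

lemma matrix_eval_zero: "matrix_eval f 0 = 0"
  by (simp add: matrix_eval_def vec_eq_iff)

lemma matrix_eval_single: "matrix_eval f (Poly_Mapping.single m a) = (\<chi> i j. a * f m $ i $ j)"
  by (simp add: matrix_eval_def extend_single)

lemma matrix_eval_scale: "matrix_eval f (scale c p) = (\<chi> i j. c * matrix_eval f p $ i $ j)"
  by (induction p rule: keys_subset_induct[OF subset_UNIV])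
    (simp_all add: matrix_eval_zero matrix_eval_single matrix_eval_add scale_add scale_zero_right vec_eq_iff distrib_left mult.assoc)

lemma matrix_scaled_mult:
  fixes A :: "'k::comm_ring_1^'n^'n"
  shows "(\<chi> i j. a * A $ i $ j) ** (\<chi> i j. b * B $ i $ j) = (\<chi> i j. (a * b) * (A ** B) $ i $ j)"
  by (simp add: matrix_matrix_mult_def vec_eq_iff sum_distrib_left ac_simps)

lemma matrix_add_rdistrib:
  fixes A B C :: "'k::comm_ring_1^'n^'n"
  shows "(B + C) ** A = B ** A + C ** A"
  by (simp add: matrix_matrix_mult_def vec_eq_iff sum.distrib distrib_right)

lemma matrix_eval_mult:
  assumes f: "\<And>m n. m \<in> carrier M \<Longrightarrow> n \<in> carrier M \<Longrightarrow> f (m \<otimes>\<^bsub>M\<^esub> n) = f m ** f n"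
    and p: "p \<in> carrier (monoid_algebra M)" and q: "q \<in> carrier (monoid_algebra M)"
  shows "matrix_eval f (p \<otimes>\<^bsub>monoid_algebra M\<^esub> q) = matrix_eval f p ** matrix_eval f q"
  using p[unfolded carrier_monoid_algebra]
proof (induction p rule: keys_subset_induct)
  case (single m a)
  from q[unfolded carrier_monoid_algebra] show ?case
  proof (induction q rule: keys_subset_induct)
    case (single n b)
    with \<open>m \<in> carrier M\<close> show ?case
      by (simp add: monoid_algebra_mult_single matrix_eval_single matrix_scaled_mult f)
  qed (simp_all add: monoid_algebra_mult_zero monoid_algebra_mult_add_right matrix_eval_zero matrix_eval_add matrix_add_ldistrib)
qed (simp_all add: monoid_algebra_mult_zero monoid_algebra_mult_add_left matrix_eval_zero matrix_eval_add matrix_add_rdistrib)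

lemma matrix_eval_pushforward: "matrix_eval f (pushforward g p) = matrix_eval (f \<circ> g) p"
  by (induction p rule: keys_subset_induct[OF subset_UNIV])
    (simp_all add: pushforward_zero pushforward_single pushforward_add matrix_eval_zero matrix_eval_single matrix_eval_add)

lemma matrix_eval_cong:
  "(\<And>m. m \<in> Poly_Mapping.keys p \<Longrightarrow> f m = g m) \<Longrightarrow> matrix_eval f p = matrix_eval g p"
  by (simp add: matrix_eval_def extend_def)

text \<open>
  Independent of the representative if \<open>f\<close>, extended linearly, vanishes on the subspace that is divided out.
\<close>

definition class_eval :: "('m \<Rightarrow> 'k^'n^'n) \<Rightarrow> ('m \<Rightarrow>\<^sub>0 'k::field) set \<Rightarrow> 'k^'n^'n" where
  "class_eval f X = matrix_eval f (SOME p. p \<in> X)"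

lemma class_eval_coset:
  fixes H :: "('m \<Rightarrow>\<^sub>0 'k::field) set"
  assumes H: "submodule H scalars (monoid_algebra M)" and f: "\<And>h. h \<in> H \<Longrightarrow> matrix_eval f h = 0"
  shows "class_eval f (H +>\<^bsub>(monoid_algebra M :: ('k, 'm \<Rightarrow>\<^sub>0 'k) module)\<^esub> p) = matrix_eval f p"
proof -
  let ?X = "H +>\<^bsub>(monoid_algebra M :: ('k, 'm \<Rightarrow>\<^sub>0 'k) module)\<^esub> p"
  have "(SOME q. q \<in> ?X) \<in> ?X" using coset_self[OF H] by (rule someI)
  then have "(SOME q. q \<in> ?X) - p \<in> H" by (simp only: mem_coset_iff[OF H])
  from f[OF this] show ?thesis by (simp add: class_eval_def matrix_eval_diff)
qed

lemma tensor_kernel_eval: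
  fixes V :: "('k::field, 'v, 'x) module_scheme" and W :: "('k, 'w, 'y) module_scheme"
  assumes V: "module scalars V" and W: "module scalars W"
    and f: "\<And>x x' y. x \<in> carrier V \<Longrightarrow> x' \<in> carrier V \<Longrightarrow> y \<in> carrier W \<Longrightarrow> f (x \<oplus>\<^bsub>V\<^esub> x', y) = f (x, y) + f (x', y)"
      "\<And>x y y'. x \<in> carrier V \<Longrightarrow> y \<in> carrier W \<Longrightarrow> y' \<in> carrier W \<Longrightarrow> f (x, y \<oplus>\<^bsub>W\<^esub> y') = f (x, y) + f (x, y')"
      "\<And>c x y. x \<in> carrier V \<Longrightarrow> y \<in> carrier W \<Longrightarrow> f (c \<odot>\<^bsub>V\<^esub> x, y) = (\<chi> i j. c * f (x, y) $ i $ j)"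
      "\<And>c x y. x \<in> carrier V \<Longrightarrow> y \<in> carrier W \<Longrightarrow> f (x, c \<odot>\<^bsub>W\<^esub> y) = (\<chi> i j. c * f (x, y) $ i $ j)"
    and h: "h \<in> tensor_kernel V W"
  shows "matrix_eval f h = 0"
proof -
  let ?A = "monoid_algebra (V \<times>\<times> W) :: ('k, 'v \<times> 'w \<Rightarrow>\<^sub>0 'k) module"
  have "submodule {q \<in> carrier ?A. matrix_eval f q = 0} scalars ?A"
    by (rule submodule_monoid_algebraI)
      (auto simp: matrix_eval_add matrix_eval_scale matrix_eval_zero add_carrier scale_carrier zero_carrier vec_eq_iff)
  moreover have "matrix_eval f r = 0" if "r \<in> tensor_relations V W" for r
    using that unfolding tensor_relations_def
    by (elim UnE CollectE exE conjE; simp add: matrix_eval_diff matrix_eval_single f vec_eq_iff)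
  ultimately show ?thesis
    using tensor_kernel_minimal[OF V W, of "{q \<in> carrier ?A. matrix_eval f q = 0}"] h tensor_relations_carrier[OF V W] by blast
qed

lemma class_eval_tensor_linear:
  fixes V :: "('k::field, 'v, 'x) module_scheme" and W :: "('k, 'w, 'y) module_scheme"
  assumes V: "module scalars V" and W: "module scalars W"
    and f: "\<And>h. h \<in> tensor_kernel V W \<Longrightarrow> matrix_eval f h = 0"
    and X: "X \<in> carrier (tensor V W)"
  shows "Y \<in> carrier (tensor V W) \<Longrightarrow> class_eval f (X \<oplus>\<^bsub>tensor V W\<^esub> Y) = class_eval f X + class_eval f Y"
    "class_eval f (c \<odot>\<^bsub>tensor V W\<^esub> X) = (\<chi> i j. c * class_eval f X $ i $ j)"
proof -
  note K = tensor_kernel_submodule[OF V W]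
  let ?A = "monoid_algebra (V \<times>\<times> W) :: ('k, 'v \<times> 'w \<Rightarrow>\<^sub>0 'k) module"
  obtain p where p: "p \<in> carrier ?A" "X = tensor_kernel V W +>\<^bsub>?A\<^esub> p"
    using X by (rule tensor_cases[OF V W])
  then show "class_eval f (c \<odot>\<^bsub>tensor V W\<^esub> X) = (\<chi> i j. c * class_eval f X $ i $ j)"
    by (simp add: tensor_def smult_quotient[OF K] class_eval_coset[OF K f] matrix_eval_scale)
  assume "Y \<in> carrier (tensor V W)"
  then obtain q where "q \<in> carrier ?A" "Y = tensor_kernel V W +>\<^bsub>?A\<^esub> q"
    by (rule tensor_cases[OF V W])
  with p show "class_eval f (X \<oplus>\<^bsub>tensor V W\<^esub> Y) = class_eval f X + class_eval f Y"
    by (simp add: tensor_def add_quotient[OF K] class_eval_coset[OF K f] matrix_eval_add)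
qed

section \<open>The enveloping algebra\<close>

lemma monoid_word_monoid: "monoid (word_monoid X)"
  by (rule monoidI) (auto simp: word_monoid_def)

context lie_algebra
begin

abbreviation word_algebra :: "('k, 'v list \<Rightarrow>\<^sub>0 'k) module" where "word_algebra \<equiv> monoid_algebra (word_monoid (carrier L))"

lemma smult_carrier: "x \<in> carrier L \<Longrightarrow> c \<odot>\<^bsub>L\<^esub> x \<in> carrier L"
  using smult_closed[of c x] by (simp add: scalars_def)

lemma enveloping_relations_carrier: "enveloping_relations L \<subseteq> carrier word_algebra"
proof -
  have "Poly_Mapping.single w c \<in> carrier word_algebra" if "set w \<subseteq> carrier L" for w c
    using that by (intro single_carrier) (auto simp: word_monoid_def lists_eq_set)
  then show ?thesis
    unfolding enveloping_relations_def by (auto intro!: diff_carrier simp: smult_carrier bracket_closed)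
qed

lemma ring_word_algebra: "ring word_algebra" by (rule ring_monoid_algebra[OF monoid_word_monoid])

lemma enveloping_kernel_ideal: "ideal (enveloping_kernel L) word_algebra"
  unfolding enveloping_kernel_def by (rule ring.genideal_ideal[OF ring_word_algebra enveloping_relations_carrier])

lemmas enveloping_kernel_submodule = ideal_imp_submodule[OF monoid_word_monoid enveloping_kernel_ideal]

lemma enveloping_relations_subset: "enveloping_relations L \<subseteq> enveloping_kernel L"
  unfolding enveloping_kernel_def by (rule ring.genideal_self[OF ring_word_algebra enveloping_relations_carrier])

lemma assoc_algebra_enveloping: "assoc_algebra (enveloping_algebra L)"
  unfolding enveloping_algebra_def by (rule assoc_algebra_quotient[OF monoid_word_monoid enveloping_kernel_ideal])

lemma one_enveloping_algebra:
  "\<one>\<^bsub>enveloping_algebra L\<^esub> = enveloping_kernel L +>\<^bsub>word_algebra\<^esub> Poly_Mapping.single [] 1"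
proof -
  have "\<one>\<^bsub>word_monoid (carrier L)\<^esub> = []" by (simp add: word_monoid_def)
  then show ?thesis
    by (simp add: enveloping_algebra_def one_quotient[OF enveloping_kernel_submodule] one_monoid_algebra)
qed

lemma letter_carrier: "x \<in> carrier L \<Longrightarrow> Poly_Mapping.single [x] c \<in> carrier word_algebra"
  by (rule single_carrier) (simp add: word_monoid_def)

lemma enveloping_map_linear: "enveloping_map L \<in> linear_maps L (enveloping_algebra L)"
proof -
  note K = enveloping_kernel_submodule
  have a: "Poly_Mapping.single [x \<oplus>\<^bsub>L\<^esub> y] 1 - (Poly_Mapping.single [x] 1 + Poly_Mapping.single [y] 1) \<in> enveloping_kernel L"
    if "x \<in> carrier L" "y \<in> carrier L" for x y
    using that by (intro subsetD[OF enveloping_relations_subset]) (auto simp: enveloping_relations_def algebra_simps)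
  have s: "Poly_Mapping.single [c \<odot>\<^bsub>L\<^esub> x] 1 - Poly_Mapping.single [x] c \<in> enveloping_kernel L"
    if "x \<in> carrier L" for c x
    using that by (intro subsetD[OF enveloping_relations_subset]) (auto simp: enveloping_relations_def)
  show ?thesis
    unfolding linear_maps_def enveloping_map_def enveloping_algebra_def
    by (auto simp: coset_in_carrier[OF K] letter_carrier add_quotient[OF K] smult_quotient[OF K] coset_eq_iff[OF K] a s)
qed

end

definition lie_representation :: "('k::field, 'v, 'x) module_scheme \<Rightarrow> ('v \<Rightarrow> 'k^'n^'n) \<Rightarrow> bool" where
  "lie_representation L \<rho> \<longleftrightarrow>
     (\<forall>x\<in>carrier L. \<forall>y\<in>carrier L. \<rho> (x \<oplus>\<^bsub>L\<^esub> y) = \<rho> x + \<rho> y) \<and>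
     (\<forall>c. \<forall>x\<in>carrier L. \<rho> (c \<odot>\<^bsub>L\<^esub> x) = (\<chi> i j. c * \<rho> x $ i $ j)) \<and>
     (\<forall>x\<in>carrier L. \<forall>y\<in>carrier L. \<rho> (x \<otimes>\<^bsub>L\<^esub> y) = \<rho> x ** \<rho> y - \<rho> y ** \<rho> x)"

text \<open>
  The extension of \<open>\<rho>\<close> from letters to words, which is multiplicative.
\<close>

definition word_matrix :: "('v \<Rightarrow> 'k::field^'n^'n) \<Rightarrow> 'v list \<Rightarrow> 'k^'n^'n" where
  "word_matrix \<rho> w = foldr (\<lambda>x A. \<rho> x ** A) w (mat 1)"

lemma word_matrix_append: "word_matrix \<rho> (v @ w) = word_matrix \<rho> v ** word_matrix \<rho> w"
  by (induction v) (simp_all add: word_matrix_def matrix_mul_assoc)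

lemma word_matrix_simps: "word_matrix \<rho> [] = mat 1" "word_matrix \<rho> [x] = \<rho> x" "word_matrix \<rho> [x, y] = \<rho> x ** \<rho> y"
  by (simp_all add: word_matrix_def)

locale lie_rep = lie_algebra L for L :: "('k::field, 'v, 'x) module_scheme" (structure) +
  fixes \<rho> :: "'v \<Rightarrow> 'k^'n^'n"
  assumes rep: "lie_representation L \<rho>"
begin

abbreviation U where "U \<equiv> enveloping_algebra L"

lemma word_eval_mult: "p \<in> carrier word_algebra \<Longrightarrow> q \<in> carrier word_algebra \<Longrightarrow>
   matrix_eval (word_matrix \<rho>) (p \<otimes>\<^bsub>word_algebra\<^esub> q) = matrix_eval (word_matrix \<rho>) p ** matrix_eval (word_matrix \<rho>) q"
  by (rule matrix_eval_mult) (simp_all add: word_monoid_def word_matrix_append)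

text \<open>
  The formal sums that evaluate to zero form an ideal, and it contains the defining relations because \<open>\<rho>\<close> is a
  representation. This is the universal property of the enveloping algebra.
\<close>

lemma enveloping_kernel_eval:
  assumes "h \<in> enveloping_kernel L"
  shows "matrix_eval (word_matrix \<rho>) h = 0"
proof -
  let ?I = "{q \<in> carrier word_algebra. matrix_eval (word_matrix \<rho>) q = 0}"
  have s: "submodule ?I scalars word_algebra"
    by (rule submodule_monoid_algebraI)
      (auto simp: matrix_eval_add matrix_eval_scale matrix_eval_zero add_carrier scale_carrier zero_carrier vec_eq_iff)
  have "ideal ?I word_algebra"
    by (rule idealI[OF ring_word_algebra submodule.axioms(1)[OF s]])
      (auto simp: word_eval_mult mult_carrier[OF monoid_word_monoid])
  moreover have "matrix_eval (word_matrix \<rho>) r = 0" if "r \<in> enveloping_relations L" for r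
    using that rep unfolding enveloping_relations_def lie_representation_def
    by (elim UnE CollectE exE conjE; simp add: matrix_eval_diff matrix_eval_single word_matrix_simps vec_eq_iff)
  ultimately have "enveloping_kernel L \<subseteq> ?I"
    unfolding enveloping_kernel_def using enveloping_relations_carrier
    by (intro ring.genideal_minimal[OF ring_word_algebra]) auto
  then show ?thesis using assms by blast
qed

definition env_rep :: "('v list \<Rightarrow>\<^sub>0 'k) set \<Rightarrow> 'k^'n^'n" where
  "env_rep = class_eval (word_matrix \<rho>)"

lemma env_rep_coset: "env_rep (enveloping_kernel L +>\<^bsub>word_algebra\<^esub> p) = matrix_eval (word_matrix \<rho>) p"
  unfolding env_rep_def by (rule class_eval_coset[OF enveloping_kernel_submodule enveloping_kernel_eval])

lemma env_rep_hom:
  assumes "X \<in> carrier U" "Y \<in> carrier U"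
  shows "env_rep (X \<oplus>\<^bsub>U\<^esub> Y) = env_rep X + env_rep Y"
    "env_rep (c \<odot>\<^bsub>U\<^esub> X) = (\<chi> i j. c * env_rep X $ i $ j)"
    "env_rep (X \<otimes>\<^bsub>U\<^esub> Y) = env_rep X ** env_rep Y"
proof -
  note K = enveloping_kernel_submodule
  obtain p q where "p \<in> carrier word_algebra" "X = enveloping_kernel L +>\<^bsub>word_algebra\<^esub> p" "q \<in> carrier word_algebra" "Y = enveloping_kernel L +>\<^bsub>word_algebra\<^esub> q"
    using assms by (auto simp: enveloping_algebra_def carrier_quotient[OF K])
  then show "env_rep (X \<oplus>\<^bsub>U\<^esub> Y) = env_rep X + env_rep Y"
    "env_rep (c \<odot>\<^bsub>U\<^esub> X) = (\<chi> i j. c * env_rep X $ i $ j)"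
    "env_rep (X \<otimes>\<^bsub>U\<^esub> Y) = env_rep X ** env_rep Y"
    by (simp_all add: enveloping_algebra_def add_quotient[OF K] smult_quotient[OF K] env_rep_coset
        mult_quotient[OF K monoid_word_monoid enveloping_kernel_ideal] matrix_eval_add matrix_eval_scale word_eval_mult)
qed

lemma env_rep_one: "env_rep \<one>\<^bsub>U\<^esub> = mat 1"
  by (simp add: one_enveloping_algebra env_rep_coset matrix_eval_single word_matrix_simps vec_eq_iff)

lemma env_rep_enveloping_map: "env_rep (enveloping_map L x) = \<rho> x"
  by (simp add: enveloping_map_def env_rep_coset matrix_eval_single word_matrix_simps vec_eq_iff)

end

section \<open>The tensor square of the enveloping algebra\<close>

context lie_rep
begin

abbreviation UU where "UU \<equiv> tensor U U"
abbreviation pair_algebra :: "('k, ('v list \<Rightarrow>\<^sub>0 'k) set \<times> ('v list \<Rightarrow>\<^sub>0 'k) set \<Rightarrow>\<^sub>0 'k) module" where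
  "pair_algebra \<equiv> monoid_algebra (U \<times>\<times> U)"
abbreviation pair_kernel where "pair_kernel \<equiv> tensor_kernel U U"
abbreviation pair_class where "pair_class p \<equiv> pair_kernel +>\<^bsub>pair_algebra\<^esub> p"

text \<open>
  The representation of \<open>U \<otimes> U\<close> on the tensor square of the representation space, on generators.
\<close>

definition pair_rep :: "('v list \<Rightarrow>\<^sub>0 'k) set \<times> ('v list \<Rightarrow>\<^sub>0 'k) set \<Rightarrow> ('k, 'n \<times> 'n) vec ^ ('n \<times> 'n)" where
  "pair_rep = (\<lambda>(X, Y). kron (env_rep X) (env_rep Y))"

lemma module_U: "module scalars U" and ring_U: "ring U"
  using assoc_algebra_enveloping by (simp_all add: assoc_algebra_def)

lemma module_L: "module scalars L" ..

lemma monoid_pairs: "monoid (U \<times>\<times> U)"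
  using ring_U by (intro DirProd_monoid) (simp_all add: ring_def)

lemmas pair_kernel_submodule = tensor_kernel_submodule[OF module_U module_U]
lemmas pair_kernel_ideal = tensor_kernel_ideal[OF assoc_algebra_enveloping assoc_algebra_enveloping]

lemma pair_kernel_eval: "h \<in> pair_kernel \<Longrightarrow> matrix_eval pair_rep h = 0"
  by (rule tensor_kernel_eval[OF module_U module_U])
    (simp_all add: pair_rep_def env_rep_hom kron_def vec_eq_iff distrib_left distrib_right ac_simps)

lemma class_eval_pair_class: "class_eval pair_rep (pair_class p) = matrix_eval pair_rep p"
  by (rule class_eval_coset[OF pair_kernel_submodule pair_kernel_eval])

lemma pair_eval_mult: "p \<in> carrier pair_algebra \<Longrightarrow> q \<in> carrier pair_algebra \<Longrightarrow>
   matrix_eval pair_rep (p \<otimes>\<^bsub>pair_algebra\<^esub> q) = matrix_eval pair_rep p ** matrix_eval pair_rep q"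
  by (rule matrix_eval_mult) (auto simp: pair_rep_def env_rep_hom kron_mult)

lemma class_eval_UU:
  assumes "X \<in> carrier UU" "Y \<in> carrier UU"
  shows "class_eval pair_rep (X \<oplus>\<^bsub>UU\<^esub> Y) = class_eval pair_rep X + class_eval pair_rep Y"
    "class_eval pair_rep (commutator UU X Y) =
       class_eval pair_rep X ** class_eval pair_rep Y - class_eval pair_rep Y ** class_eval pair_rep X"
    "commutator UU X Y \<in> carrier UU"
proof -
  obtain p q where *: "p \<in> carrier pair_algebra" "X = pair_class p" "q \<in> carrier pair_algebra" "Y = pair_class q"
    using assms by (auto simp: tensor_def carrier_quotient[OF pair_kernel_submodule])
  then have c: "commutator UU X Y = pair_class (p \<otimes>\<^bsub>pair_algebra\<^esub> q - q \<otimes>\<^bsub>pair_algebra\<^esub> p)"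
    unfolding tensor_def by (simp add: commutator_quotient[OF pair_kernel_submodule monoid_pairs pair_kernel_ideal])
  have cc: "p \<otimes>\<^bsub>pair_algebra\<^esub> q - q \<otimes>\<^bsub>pair_algebra\<^esub> p \<in> carrier pair_algebra"
    using * by (intro diff_carrier mult_carrier[OF monoid_pairs])
  show "class_eval pair_rep (X \<oplus>\<^bsub>UU\<^esub> Y) = class_eval pair_rep X + class_eval pair_rep Y"
    using * by (simp add: tensor_def add_quotient[OF pair_kernel_submodule] class_eval_pair_class matrix_eval_add)
  show "class_eval pair_rep (commutator UU X Y) =
       class_eval pair_rep X ** class_eval pair_rep Y - class_eval pair_rep Y ** class_eval pair_rep X"
    unfolding c using * by (simp add: class_eval_pair_class matrix_eval_diff pair_eval_mult)
  show "commutator UU X Y \<in> carrier UU"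
    using coset_in_carrier[OF pair_kernel_submodule cc] unfolding c by (simp only: tensor_def)
qed

abbreviation \<Delta> where
  "\<Delta> x \<equiv> pure_tensor U U (enveloping_map L x) \<one>\<^bsub>U\<^esub> \<oplus>\<^bsub>UU\<^esub> pure_tensor U U \<one>\<^bsub>U\<^esub> (enveloping_map L x)"

lemma class_eval_pure_tensor: "class_eval pair_rep (pure_tensor U U X Y) = kron (env_rep X) (env_rep Y)"
proof -
  have "class_eval pair_rep (pure_tensor U U X Y) = matrix_eval pair_rep (Poly_Mapping.single (X, Y) 1)"
    by (simp add: pure_tensor_def class_eval_pair_class)
  then show ?thesis by (simp add: matrix_eval_single pair_rep_def vec_eq_iff)
qed

lemma Delta:
  assumes "x \<in> carrier L"
  shows "\<Delta> x \<in> carrier UU"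
    "class_eval pair_rep (\<Delta> x) = kron (\<rho> x) (mat 1) + kron (mat 1) (\<rho> x)"
proof -
  have e: "enveloping_map L x \<in> carrier U" using enveloping_map_linear assms by (auto simp: linear_maps_def)
  have o: "\<one>\<^bsub>U\<^esub> \<in> carrier U" using ring_U by (simp add: ring.ring_simprules)
  note c = pure_tensor_carrier[OF module_U module_U]
  show "\<Delta> x \<in> carrier UU"
    using abelian_group.axioms(1)[OF module.axioms(2)[OF module_tensor[OF module_U module_U]]]
    by (intro abelian_monoid.a_closed c e o)
  show "class_eval pair_rep (\<Delta> x) = kron (\<rho> x) (mat 1) + kron (mat 1) (\<rho> x)"
    by (simp add: class_eval_UU(1) c e o class_eval_pure_tensor env_rep_one env_rep_enveloping_map)
qed

definition tensor_rep :: "('v \<times> 'v \<Rightarrow>\<^sub>0 'k) set \<Rightarrow> ('k, 'n \<times> 'n) vec ^ ('n \<times> 'n)" where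
  "tensor_rep = class_eval (\<lambda>(x, y). kron (\<rho> x) (\<rho> y))"

lemma tensor_rep_coset:
  "tensor_rep (tensor_kernel L L +>\<^bsub>(monoid_algebra (L \<times>\<times> L) :: ('k, 'v \<times> 'v \<Rightarrow>\<^sub>0 'k) module)\<^esub> p)
    = matrix_eval (\<lambda>(x, y). kron (\<rho> x) (\<rho> y)) p"
proof -
  have "matrix_eval (\<lambda>(x, y). kron (\<rho> x) (\<rho> y)) h = 0" if "h \<in> tensor_kernel L L" for h
    using rep by (intro tensor_kernel_eval[OF module_L module_L _ _ _ _ that])
      (simp_all add: lie_representation_def kron_def vec_eq_iff distrib_left distrib_right ac_simps)
  then show ?thesis
    unfolding tensor_rep_def by (rule class_eval_coset[OF tensor_kernel_submodule[OF module_L module_L]])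
qed

text \<open>
  Passing from \<open>L \<otimes> L\<close> to \<open>U \<otimes> U\<close> does not change the matrix. The map
  is \<open>L \<rightarrow> U\<close> on both factors, and \<open>\<rho>\<close> extends along it.
\<close>

lemma tensor_map_enveloping:
  assumes "X \<in> carrier (tensor L L)"
  shows "tensor_map U U (enveloping_map L) (enveloping_map L) X \<in> carrier UU"
    "class_eval pair_rep (tensor_map U U (enveloping_map L) (enveloping_map L) X) = tensor_rep X"
proof -
  obtain p where p: "p \<in> carrier (monoid_algebra (L \<times>\<times> L) :: ('k, 'v \<times> 'v \<Rightarrow>\<^sub>0 'k) module)"
    and X: "X = tensor_kernel L L +>\<^bsub>(monoid_algebra (L \<times>\<times> L) :: ('k, 'v \<times> 'v \<Rightarrow>\<^sub>0 'k) module)\<^esub> p"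
    using assms by (rule tensor_cases[OF module_L module_L])
  note m = tensor_map_coset[OF module_L module_L module_U module_U enveloping_map_linear enveloping_map_linear p, folded X]
  have e: "enveloping_map L x \<in> carrier U" if "x \<in> carrier L" for x
    using enveloping_map_linear that by (auto simp: linear_maps_def)
  show "tensor_map U U (enveloping_map L) (enveloping_map L) X \<in> carrier UU"
    unfolding m tensor_def
    by (intro coset_in_carrier[OF pair_kernel_submodule] pushforward_carrier[OF _ p]) (auto simp: e)
  show "class_eval pair_rep (tensor_map U U (enveloping_map L) (enveloping_map L) X) = tensor_rep X"
  proof -
    let ?h = "\<lambda>(x, y). (enveloping_map L x, enveloping_map L y)"
    have "class_eval pair_rep (tensor_map U U (enveloping_map L) (enveloping_map L) X) = matrix_eval pair_rep (pushforward ?h p)"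
      by (simp add: m class_eval_pair_class)
    also have "\<dots> = matrix_eval (\<lambda>(x, y). kron (\<rho> x) (\<rho> y)) p"
      unfolding matrix_eval_pushforward
      by (rule matrix_eval_cong) (simp add: pair_rep_def env_rep_enveloping_map case_prod_beta)
    finally show ?thesis by (simp only: X tensor_rep_coset)
  qed
qed

text \<open>
  The compatibility condition of a coassociative Lie algebra as seen by a representation \<open>\<rho>\<close>. Here
  \<open>E x\<close> is the image of \<open>x \<otimes> 1 + 1 \<otimes> x\<close> and \<open>P x\<close> that of \<open>\<delta> x\<close>.
\<close>

theorem comult_bracket_rep:
  assumes "coassociative_lie_algebra L \<delta>" and a: "a \<in> carrier L" and b: "b \<in> carrier L"
  defines "E \<equiv> \<lambda>x. kron (\<rho> x) (mat 1) + kron (mat 1) (\<rho> x)"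
    and "P \<equiv> \<lambda>x. tensor_rep (\<delta> x)"
  shows "P (a \<otimes>\<^bsub>L\<^esub> b) = (E a ** P b - P b ** E a) + (P a ** E b - E b ** P a) + (P a ** P b - P b ** P a)"
proof -
  interpret coassociative_lie_algebra L \<delta> by fact
  let ?d = "\<lambda>x. tensor_map U U (enveloping_map L) (enveloping_map L) (\<delta> x)"
  have d: "\<delta> x \<in> carrier (tensor L L)" if "x \<in> carrier L" for x
    using comult_linear that by (auto simp: linear_maps_def)
  note t = tensor_map_enveloping[OF d]
  have eq: "?d (a \<otimes>\<^bsub>L\<^esub> b) = commutator UU (\<Delta> a) (?d b) \<oplus>\<^bsub>UU\<^esub> commutator UU (?d a) (\<Delta> b)
      \<oplus>\<^bsub>UU\<^esub> commutator UU (?d a) (?d b)"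
    using comult_bracket[OF a b] by (simp add: Let_def)
  have cl: "X \<oplus>\<^bsub>UU\<^esub> Y \<in> carrier UU" if "X \<in> carrier UU" "Y \<in> carrier UU" for X Y
    using abelian_group.axioms(1)[OF module.axioms(2)[OF module_tensor[OF module_U module_U]]] that
    by (intro abelian_monoid.a_closed)
  have "P (a \<otimes>\<^bsub>L\<^esub> b) = class_eval pair_rep (?d (a \<otimes>\<^bsub>L\<^esub> b))"
    by (simp add: P_def t(2) a b bracket_closed)
  also have "\<dots> = (E a ** P b - P b ** E a) + (P a ** E b - E b ** P a) + (P a ** P b - P b ** P a)"
    unfolding eq E_def P_def using a b
    by (simp only: class_eval_UU cl Delta t)
  finally show ?thesis .
qed

end

section \<open>Tensors of skew-symmetric matrices\<close>

text \<open>
  The matrix of the cross product with \<open>v\<close>.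
\<close>

definition skew :: "'k::comm_ring_1^3 \<Rightarrow> 'k^3^3" where
  "skew v = vector [vector [0, - (v$3), v$2], vector [v$3, 0, - (v$1)], vector [- (v$2), v$1, 0]]"

text \<open>
  The linear map that sends \<open>v w\<^sup>T\<close> to the Kronecker product of the matrices of \<open>v\<close> and \<open>w\<close>. A matrix
  \<open>M\<close> stands for the tensor with coefficients \<open>M\<^sub>i\<^sub>j\<close> in \<open>k\<^sup>3 \<otimes> k\<^sup>3\<close>.
\<close>

definition skew_tensor :: "'k::comm_ring_1^3^3 \<Rightarrow> ('k, 3 \<times> 3) vec ^ (3 \<times> 3)" where
  "skew_tensor M = (\<chi> x y. \<Sum>i\<in>UNIV. \<Sum>j\<in>UNIV.
     M$i$j * skew (axis i 1) $ fst x $ fst y * skew (axis j 1) $ snd x $ snd y)"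

lemma sum_33: "(\<Sum>z\<in>(UNIV::(3\<times>3) set). f z) = (\<Sum>p\<in>UNIV. \<Sum>r\<in>UNIV. f (p, r))"
  by (simp add: sum.cartesian_product flip: UNIV_Times_UNIV)

lemma skew_tensor_matrix: "skew_tensor (\<chi> i j. v$i * w$j) $ (p,r) $ (q,s) = skew v $ p $ q * skew w $ r $ s"
  using exhaust_3[of p] exhaust_3[of q] exhaust_3[of r] exhaust_3[of s]
  by (auto simp: skew_tensor_def skew_def sum_3 axis_def)

text \<open>
  Each of the two factors changes its sign under transposition.
\<close>

lemma transpose_skew_tensor: "transpose (skew_tensor M) = skew_tensor M"
  by (simp add: skew_tensor_def skew_def vec_eq_iff transpose_def forall_3 sum_3 axis_def)

lemma forall_33: "(\<forall>z::3\<times>3. P z) \<longleftrightarrow> (\<forall>p r. P (p, r))" by auto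

text \<open>
  The action of \<open>a\<close> on \<open>k\<^sup>3 \<otimes> k\<^sup>3\<close>. On matrices it is a commutator because the matrix of \<open>a\<close> is
  skew-symmetric: \<open>(a \<times> v) w\<^sup>T + v (a \<times> w)\<^sup>T = S v w\<^sup>T - v w\<^sup>T S\<close> for \<open>S\<close> the matrix of \<open>a\<close>.
\<close>

lemma commutator_skew_tensor:
  "(kron (skew a) (mat 1) + kron (mat 1) (skew a)) ** skew_tensor N
     - skew_tensor N ** (kron (skew a) (mat 1) + kron (mat 1) (skew a))
   = skew_tensor (skew a ** N - N ** skew a)"
proof -
  have sum: "(\<Sum>p\<in>UNIV. if p = q then f p else 0) = f q" "(\<Sum>p\<in>UNIV. if q = p then f p else 0) = f q" for q :: 3 and f :: "3 \<Rightarrow> 'a"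
     by simp_all
  have dsum: "(\<Sum>p\<in>UNIV. \<Sum>r\<in>UNIV. if p = q then g p r else 0) = (\<Sum>r\<in>UNIV. g q r)" 
     "(\<Sum>p\<in>UNIV. \<Sum>r\<in>UNIV. if q = p then g p r else 0) = (\<Sum>r\<in>UNIV. g q r)" for q :: 3 and g :: "3 \<Rightarrow> 3 \<Rightarrow> 'a"
     by (subst sum.swap; simp)+
  have k: "((kron A (mat 1) + kron (mat 1) B) ** X) $ (p,r) $ z = (\<Sum>i\<in>UNIV. A$p$i * X$(i,r)$z) + (\<Sum>i\<in>UNIV. B$r$i * X$(p,i)$z)"
     "(X ** (kron A (mat 1) + kron (mat 1) B)) $ z $ (p,r) = (\<Sum>i\<in>UNIV. X$z$(i,r) * A$i$p) + (\<Sum>i\<in>UNIV. X$z$(p,i) * B$i$r)" 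
    for A B :: "'a^3^3" and X p r z
    by (simp_all add: kron_def matrix_matrix_mult_def mat_def sum_33 algebra_simps sum.distrib if_distrib[where f="\<lambda>x. _ * x"] if_distrib[where f="\<lambda>x. x * _"] sum dsum cong: if_cong)
  let ?E = "\<lambda>i. skew (axis i (1::'a))"
  have ad: "(\<Sum>c\<in>UNIV. skew a$p$c * ?E i$c$q) - (\<Sum>c\<in>UNIV. ?E i$p$c * skew a$c$q) = (\<Sum>k\<in>UNIV. skew a$k$i * ?E k$p$q)" for p q i
    using exhaust_3[of p] exhaust_3[of q] exhaust_3[of i] by (auto simp: sum_3 skew_def axis_def)
  \<comment> \<open>The right factor produces \<open>N\<close> times the transpose of the matrix of \<open>a\<close>, hence the sign.\<close>
  have anti: "skew a$k$i = - (skew a$i$k)" for i k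
    using exhaust_3[of k] exhaust_3[of i] by (auto simp: skew_def)
  have neg: "(\<Sum>k\<in>UNIV. N$i$k * skew a$j$k) = - (\<Sum>k\<in>UNIV. N$i$k * skew a$k$j)" for i j
    by (simp add: anti[of j] sum_negf)
  have left: "(\<Sum>c\<in>UNIV. A c * (\<Sum>i\<in>UNIV. \<Sum>j\<in>UNIV. N$i$j * e i c * f j)) = (\<Sum>i\<in>UNIV. \<Sum>j\<in>UNIV. N$i$j * (\<Sum>c\<in>UNIV. A c * e i c) * f j)"
    "(\<Sum>c\<in>UNIV. (\<Sum>i\<in>UNIV. \<Sum>j\<in>UNIV. N$i$j * e i c * f j) * A c) = (\<Sum>i\<in>UNIV. \<Sum>j\<in>UNIV. N$i$j * (\<Sum>c\<in>UNIV. e i c * A c) * f j)"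
    for A :: "3 \<Rightarrow> 'a" and e f by (simp_all add: sum_3 algebra_simps)
  have right: "(\<Sum>c\<in>UNIV. A c * (\<Sum>i\<in>UNIV. \<Sum>j\<in>UNIV. N$i$j * f i * e j c)) = (\<Sum>i\<in>UNIV. \<Sum>j\<in>UNIV. N$i$j * f i * (\<Sum>c\<in>UNIV. A c * e j c))"
    "(\<Sum>c\<in>UNIV. (\<Sum>i\<in>UNIV. \<Sum>j\<in>UNIV. N$i$j * f i * e j c) * A c) = (\<Sum>i\<in>UNIV. \<Sum>j\<in>UNIV. N$i$j * f i * (\<Sum>c\<in>UNIV. e j c * A c))"
    for A :: "3 \<Rightarrow> 'a" and e f by (simp_all add: sum_3 algebra_simps)
  have "((kron (skew a) (mat 1) + kron (mat 1) (skew a)) ** skew_tensor N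
     - skew_tensor N ** (kron (skew a) (mat 1) + kron (mat 1) (skew a))) $ (p,r) $ (q,s)
   = skew_tensor (skew a ** N - N ** skew a) $ (p,r) $ (q,s)" for p r q s
  proof -
    have "((kron (skew a) (mat 1) + kron (mat 1) (skew a)) ** skew_tensor N
     - skew_tensor N ** (kron (skew a) (mat 1) + kron (mat 1) (skew a))) $ (p,r) $ (q,s)
     = (\<Sum>i\<in>UNIV. \<Sum>j\<in>UNIV. N$i$j * ((\<Sum>c\<in>UNIV. skew a$p$c * ?E i$c$q) - (\<Sum>c\<in>UNIV. ?E i$p$c * skew a$c$q)) * ?E j$r$s)
      + (\<Sum>i\<in>UNIV. \<Sum>j\<in>UNIV. N$i$j * ?E i$p$q * ((\<Sum>c\<in>UNIV. skew a$r$c * ?E j$c$s) - (\<Sum>c\<in>UNIV. ?E j$r$c * skew a$c$s)))"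
      unfolding vector_minus_component k 
      by (simp add: skew_tensor_def left right left_diff_distrib right_diff_distrib sum_subtractf)
    also have "\<dots> = (\<Sum>i\<in>UNIV. \<Sum>j\<in>UNIV. (\<Sum>k\<in>UNIV. skew a$i$k * N$k$j) * ?E i$p$q * ?E j$r$s)
       + (\<Sum>i\<in>UNIV. \<Sum>j\<in>UNIV. (\<Sum>k\<in>UNIV. N$i$k * skew a$j$k) * ?E i$p$q * ?E j$r$s)"
      unfolding ad by (simp add: sum_3 algebra_simps)
    also have "\<dots> = skew_tensor (skew a ** N - N ** skew a) $ (p,r) $ (q,s)"
      by (simp add: neg skew_tensor_def matrix_matrix_mult_def left_diff_distrib sum_subtractf sum_negf)
    finally show ?thesis .
  qed
  then show ?thesis by (simp add: vec_eq_iff)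
qed

lemma skew_tensor_inject: "skew_tensor M = skew_tensor N \<longleftrightarrow> M = N"
  by (auto simp: skew_tensor_def skew_def mat_def axis_def sum_33 forall_33 forall_3 sum_3 vec_eq_iff)

text \<open>
  The identity \<open>a \<times> (b \<times> v) = (a \<bullet> v) b - (a \<bullet> b) v\<close> for basis vectors \<open>a\<close> and \<open>b\<close>.
\<close>

lemma skew_axis_mult:
  "(\<Sum>c\<in>UNIV. skew (axis i (1::'k::comm_ring_1)) $ p $ c * skew (axis k 1) $ c $ q) =
     (if i = q \<and> k = p then 1 else 0) - (if i = k \<and> p = q then 1 else 0)"
  using exhaust_3[of i] exhaust_3[of p] exhaust_3[of k] exhaust_3[of q]
  by (elim disjE; hypsubst; simp add: skew_def axis_def sum_3)

lemma sum_mult_bilinear: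
  fixes a b :: "'x \<Rightarrow> 'c \<Rightarrow> 'k::comm_semiring_0"
  shows "(\<Sum>c\<in>C. (\<Sum>x\<in>X. f x * a x c) * (\<Sum>y\<in>Y. g y * b y c))
     = (\<Sum>x\<in>X. \<Sum>y\<in>Y. f x * g y * (\<Sum>c\<in>C. a x c * b y c))"
proof -
  have "(\<Sum>c\<in>C. (\<Sum>x\<in>X. f x * a x c) * (\<Sum>y\<in>Y. g y * b y c))
      = (\<Sum>c\<in>C. \<Sum>x\<in>X. \<Sum>y\<in>Y. f x * g y * (a x c * b y c))"
    by (simp add: sum_product ac_simps)
  also have "\<dots> = (\<Sum>x\<in>X. \<Sum>c\<in>C. \<Sum>y\<in>Y. f x * g y * (a x c * b y c))"
    by (rule sum.swap)
  also have "\<dots> = (\<Sum>x\<in>X. \<Sum>y\<in>Y. \<Sum>c\<in>C. f x * g y * (a x c * b y c))"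
    by (intro sum.cong refl sum.swap)
  finally show ?thesis by (simp add: sum_distrib_left)
qed

text \<open>
  Each factor of a product of two tensors contributes an outer product minus a multiple of the identity; expanding
  these gives four terms.
\<close>

lemma skew_tensor_mult:
  "(skew_tensor M ** skew_tensor N) $ (p,r) $ (q,s) =
    M$q$s * N$p$r - (if r = s then \<Sum>j\<in>UNIV. M$q$j * N$p$j else 0)
     - (if p = q then \<Sum>i\<in>UNIV. M$i$s * N$i$r else 0)
     + (if p = q \<and> r = s then \<Sum>i\<in>UNIV. \<Sum>j\<in>UNIV. M$i$j * N$i$j else 0)"
  for M N :: "'k::comm_ring_1^3^3"
proof -
  let ?E = "\<lambda>i. skew (axis i (1::'k))"
  let ?d = "\<lambda>i k p q. (if i = q \<and> k = p then 1 else 0) - (if i = k \<and> p = q then 1 else 0) :: 'k"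
  have d: "(\<Sum>k\<in>UNIV. ?d i k p q * g k) = (if i = q then g p else 0) - (if p = q then g i else 0)" for i p q :: 3 and g
    by (auto simp: left_diff_distrib sum_subtractf if_distrib[where f="\<lambda>x. x * _"] cong: if_cong)
  have h: "(\<Sum>i\<in>UNIV. \<Sum>j\<in>UNIV. M$i$j * ((if i = q then A j else 0) - C i j)) = (\<Sum>j\<in>UNIV. M$q$j * A j) - (\<Sum>i\<in>UNIV. \<Sum>j\<in>UNIV. M$i$j * C i j)"
    for q :: 3 and A C
  proof -
    have "(\<Sum>i\<in>UNIV. \<Sum>j\<in>UNIV. M$i$j * (if i = q then A j else 0)) = (\<Sum>i\<in>UNIV. if i = q then \<Sum>j\<in>UNIV. M$i$j * A j else 0)"
      by (rule sum.cong) auto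
    then show ?thesis by (simp add: right_diff_distrib sum_subtractf)
  qed
  have g: "(\<Sum>j\<in>UNIV. m j * ((if j = s then a else 0) - (if r = s then b j else 0))) = m s * a - (if r = s then \<Sum>j\<in>UNIV. m j * b j else 0)"
    for r s :: 3 and a and m b :: "3 \<Rightarrow> 'k"
    by (auto simp: right_diff_distrib sum_subtractf if_distrib[where f="\<lambda>x. _ * x"] cong: if_cong)
  have G: "skew_tensor M $ z $ w = (\<Sum>x\<in>UNIV. M$fst x$snd x * (?E (fst x) $ fst z $ fst w * ?E (snd x) $ snd z $ snd w))" for M :: "'k^3^3" and z w
    by (simp add: skew_tensor_def sum_33 mult.assoc)
  have "(skew_tensor M ** skew_tensor N) $ z $ w = 
     (\<Sum>c\<in>UNIV. (\<Sum>x\<in>UNIV. M$fst x$snd x * (?E (fst x) $ fst z $ fst c * ?E (snd x) $ snd z $ snd c)) * 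
        (\<Sum>y\<in>UNIV. N$fst y$snd y * (?E (fst y) $ fst c $ fst w * ?E (snd y) $ snd c $ snd w)))" for z w
    unfolding matrix_matrix_mult_def by (simp add: G)
  then have "(skew_tensor M ** skew_tensor N) $ (p,r) $ (q,s) = (\<Sum>x\<in>UNIV. \<Sum>y\<in>UNIV. M$fst x$snd x * N$fst y$snd y *
      (\<Sum>c\<in>UNIV. (?E (fst x) $ p $ fst c * ?E (snd x) $ r $ snd c) * (?E (fst y) $ fst c $ q * ?E (snd y) $ snd c $ s)))"
    by (simp add: sum_mult_bilinear)
  also have "\<dots> = (\<Sum>x\<in>UNIV. \<Sum>y\<in>UNIV. M$fst x$snd x * N$fst y$snd y *
       (?d (fst x) (fst y) p q * ?d (snd x) (snd y) r s))"
    unfolding skew_axis_mult[symmetric] sum_product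
    by (simp add: sum_33 ac_simps)
  also have "\<dots> = (\<Sum>i\<in>UNIV. \<Sum>j\<in>UNIV. M$i$j * (\<Sum>k\<in>UNIV. ?d i k p q * (\<Sum>l\<in>UNIV. ?d j l r s * N$k$l)))"
    by (simp only: sum_33 fst_conv snd_conv sum_distrib_left ac_simps)
  also have "\<dots> = (\<Sum>i\<in>UNIV. \<Sum>j\<in>UNIV. M$i$j * (\<Sum>k\<in>UNIV. ?d i k p q * ((if j = s then N$k$r else 0) - (if r = s then N$k$j else 0))))"
    unfolding d ..
  also have "\<dots> = (\<Sum>i\<in>UNIV. \<Sum>j\<in>UNIV. M$i$j * 
     ((if i = q then (if j = s then N$p$r else 0) - (if r = s then N$p$j else 0) else 0) - 
      (if p = q then (if j = s then N$i$r else 0) - (if r = s then N$i$j else 0) else 0)))"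
    unfolding d ..
  also have "\<dots> = (\<Sum>j\<in>UNIV. M$q$j * ((if j = s then N$p$r else 0) - (if r = s then N$p$j else 0)))
     - (if p = q then \<Sum>i\<in>UNIV. \<Sum>j\<in>UNIV. M$i$j * ((if j = s then N$i$r else 0) - (if r = s then N$i$j else 0)) else 0)"
    unfolding h by simp
  also have "\<dots> = (M$q$s * N$p$r - (if r = s then \<Sum>j\<in>UNIV. M$q$j * N$p$j else 0))
     - (if p = q then \<Sum>i\<in>UNIV. M$i$s * N$i$r - (if r = s then \<Sum>j\<in>UNIV. M$i$j * N$i$j else 0) else 0)"
    unfolding g ..
  finally show ?thesis
    by (auto simp: sum_subtractf)
qed

text \<open>
  Put \<open>c = M\<^sub>p\<^sub>j N\<^sub>q\<^sub>l - M\<^sub>q\<^sub>l N\<^sub>p\<^sub>j\<close>. By \<open>skew_tensor_mult\<close> commutation says that \<open>c\<close> is zero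
  when \<open>p \<noteq> q\<close> and \<open>j \<noteq> l\<close>. If just one of these holds, the three values of \<open>c\<close> along the other index
  are all equal to their sum, so twice that sum is zero.
\<close>

lemma skew_tensor_commute_imp_proportional:
  fixes M N :: "'k::field^3^3"
  assumes two: "(2::'k) \<noteq> 0"
    and comm: "skew_tensor M ** skew_tensor N = skew_tensor N ** skew_tensor M"
  shows "M$p$j * N$q$l = M$q$l * N$p$j"
proof -
  define c where "c p q j l = M$p$j * N$q$l - M$q$l * N$p$j" for p q j l
  have e: "(skew_tensor M ** skew_tensor N) $ (q,l) $ (p,j) = (skew_tensor N ** skew_tensor M) $ (q,l) $ (p,j)" for p q j l
    using comm by simp
  have main: "c p q j l = (if j = l then \<Sum>i\<in>UNIV. c p q i i else 0) + (if p = q then \<Sum>i\<in>UNIV. c i i j l else 0)" for p q j l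
    using e[of q l p j] unfolding skew_tensor_mult
    by (auto simp: c_def sum_subtractf algebra_simps)
  \<comment> \<open>Summing the three equations gives \<open>S = 3 S\<close> for the sum \<open>S\<close> of the values.\<close>
  have diag: "f i = 0" if f: "\<And>i. f i = sum f UNIV" for f :: "3 \<Rightarrow> 'k" and i
  proof -
    have "2 * sum f UNIV = f 1 + f 2 + f 3 - sum f UNIV" using f[of 1] f[of 2] f[of 3] by simp
    then have "2 * sum f UNIV = 0" by (simp add: sum_3)
    then show ?thesis using two f[of i] by simp
  qed
  have "c p q j l = 0"
  proof (cases "p = q"; cases "j = l")
    assume "p = q" "j = l" then show ?thesis by (simp add: c_def)
  next
    assume a: "p = q" "j \<noteq> l"
    have "c p p j l = 0" by (rule diag[of "\<lambda>p. c p p j l"], subst main) (simp add: a)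
    with a show ?thesis by simp
  next
    assume a: "p \<noteq> q" "j = l"
    have "c p q j j = 0" by (rule diag[of "\<lambda>j. c p q j j"], subst main) (simp add: a)
    with a show ?thesis by simp
  next
    assume "p \<noteq> q" "j \<noteq> l" then show ?thesis using main[of p q j l] by simp
  qed
  then show ?thesis by (simp add: c_def)
qed

lemma skew_tensor_linear:
  "skew_tensor (M + N) = skew_tensor M + skew_tensor N"
  "skew_tensor (M - N) = skew_tensor M - skew_tensor N"
  "skew_tensor (\<chi> i j. c * M$i$j) = (\<chi> i j. c * skew_tensor M$i$j)"
  by (simp_all add: skew_tensor_def vec_eq_iff sum_33 algebra_simps sum.distrib sum_subtractf sum_distrib_left)

lemma transpose_matrix_diff: "transpose (A - B) = transpose A - transpose B"
  by (simp add: transpose_def vec_eq_iff)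

text \<open>
  The left side of the assumed equation is symmetric and the right side skew-symmetric, so both vanish. In
  the enveloping algebra, transposition is the antipode, under which \<open>L \<otimes> L\<close> is fixed.
\<close>

lemma skew_tensor_separates:
  fixes M N K :: "'k::field^3^3"
  assumes two: "(2::'k) \<noteq> 0"
    and eq: "skew_tensor K = skew_tensor M ** skew_tensor N - skew_tensor N ** skew_tensor M"
  shows "K = 0 \<and> skew_tensor M ** skew_tensor N = skew_tensor N ** skew_tensor M"
proof -
  let ?X = "skew_tensor M" and ?Y = "skew_tensor N"
  have "skew_tensor K = transpose (skew_tensor K)" by (simp add: transpose_skew_tensor)
  also have "\<dots> = ?Y ** ?X - ?X ** ?Y"
    unfolding eq by (simp add: transpose_matrix_diff matrix_transpose_mul transpose_skew_tensor)
  also have "\<dots> = - skew_tensor K" by (simp add: eq)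
  finally have "skew_tensor K $ x $ y = - skew_tensor K $ x $ y" for x y
    by (metis vector_uminus_component)
  then have "2 * skew_tensor K $ x $ y = 0" for x y by (metis add.right_inverse mult_2)
  then have 0: "skew_tensor K = 0" using two by (simp add: vec_eq_iff)
  moreover have "skew_tensor 0 = (0 :: ('k, 3 \<times> 3) vec ^ (3 \<times> 3))" by (simp add: skew_tensor_def vec_eq_iff)
  ultimately have "K = 0" by (metis skew_tensor_inject)
  then show ?thesis using 0 eq by simp
qed

section \<open>Cocycles of rank one\<close>

text \<open>
  For \<open>n = 3\<close> the equation says that \<open>l \<times> v\<close> acts on the bilinear form \<open>B\<close> by the scalar \<open>l \<bullet> v\<close>, with the
  double cross products \<open>(l \<times> v) \<times> x\<close> expanded. For \<open>v = l\<close> it gives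
  \<open>(l \<bullet> l) B = 0\<close>. If \<open>l \<bullet> l = 0\<close>, then suitable arguments give \<open>B l l = 0\<close>, next \<open>B x l = B l x = 0\<close>, and
  for \<open>l \<bullet> v = 1\<close> finally \<open>3 B v v = 0\<close> and \<open>2 B v y = 2 B x v = 0\<close>, which determines \<open>B\<close>.
\<close>

lemma double_cross_eigenform_zero:
  fixes l :: "'k::field^'n" and B :: "'k^'n \<Rightarrow> 'k^'n \<Rightarrow> 'k"
  assumes "(2::'k) \<noteq> 0" "(3::'k) \<noteq> 0" "l \<noteq> 0" 
   and eq: "\<And>v x y. scalar_product l v * B x y = 
    - scalar_product l x * B v y + scalar_product v x * B l y - scalar_product l y * B x v + scalar_product v y * B x l"
  shows "B x y = 0"
proof (cases "scalar_product l l = 0")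
  case False
  then show ?thesis using eq[of l x y] by simp
next
  case True
  obtain i where i: "l$i \<noteq> 0" using assms by (auto simp: vec_eq_iff)
  \<comment> \<open>A vector with scalar product \<open>1\<close> with \<open>l\<close>.\<close>
  define v where "v = axis i (1 / l$i)"
  have lv: "scalar_product l v = 1" "scalar_product v l = 1" using i unfolding v_def scalar_product_def axis_def
    by (simp_all add: if_distrib if_distribR cong: if_cong)
  have com: "scalar_product x y = scalar_product y x" for x y :: "'k^'n"
    unfolding scalar_product_def by (simp add: mult.commute)
  have two_neq_one: "(2::'k) \<noteq> 1" by (metis one_add_one add_cancel_right_right zero_neq_one)
  have ll: "B l l = 0" using two_neq_one eq[of v l l] True lv by simp
  have r: "B x l = 0" for x using eq[of x v l] True lv ll by (simp add: com)
  have l: "B l x = 0" for x using eq[of x l v] True lv ll by (simp add: com)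
  \<comment> \<open>The values on \<open>v\<close> determine \<open>B\<close>.\<close>
  have red: "B x y = - scalar_product l x * B v y - scalar_product l y * B x v" for x y 
    using eq[of v x y] lv l r by simp
  have "B v v = - B v v - B v v" using red[of v v] lv by simp
  then have "3 * B v v = 0" by (simp add: algebra_simps)
  then have vv: "B v v = 0" using assms by simp
  have "2 * B v y = 0" for y using red[of v y] lv vv by simp
  then have 1: "B v y = 0" for y using assms by simp
  have "2 * B x v = 0" for x using red[of x v] lv vv by simp
  then have 2: "B x v = 0" for x using assms by simp
  show ?thesis using red[of x y] 1 2 by simp
qed

text \<open>
  A skew-symmetric matrix moves to the other side of the scalar product with a sign, and
  \<open>(l \<times> v) \<times> x = (l \<bullet> x) v - (v \<bullet> x) l\<close>.
\<close>

lemma matrix_form_double_cross: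
  fixes B :: "'k::comm_ring_1^3^3"
  defines "b x y \<equiv> scalar_product x (B *v y)"
  shows "scalar_product x ((skew (skew l *v v) ** B - B ** skew (skew l *v v)) *v y) =
     - scalar_product l x * b v y + scalar_product v x * b l y
     - scalar_product l y * b x v + scalar_product v y * b x l"
  unfolding b_def scalar_product_def matrix_vector_mult_def matrix_matrix_mult_def skew_def
  by (simp add: sum_3 algebra_simps)

text \<open>
  A cocycle of the form \<open>a \<mapsto> (l \<bullet> a) B\<close>. For consecutive basis vectors \<open>a\<close>, \<open>b\<close> the cocycle equation is the
  eigenvector equation for \<open>l \<times> v\<close> with \<open>v\<close> the third basis vector.
\<close>

lemma rank_one_cocycle_imp_zero:
  fixes B :: "'k::field^3^3"
  assumes two: "(2::'k) \<noteq> 0" and three: "(3::'k) \<noteq> 0" and l: "l \<noteq> 0"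
    and cocycle: "\<And>a b i j. scalar_product l (skew a *v b) * B$i$j =
       scalar_product l b * (skew a ** B - B ** skew a)$i$j
       - scalar_product l a * (skew b ** B - B ** skew b)$i$j"
  shows "B = 0"
proof -
  have ev: "scalar_product l v * B$i$j = (skew (skew l *v v) ** B - B ** skew (skew l *v v))$i$j" for v i j
  proof -
    define c where "c a = (skew a ** B - B ** skew a)$i$j" for a
    \<comment> \<open>The three instances of the cocycle equation below only involve basis vectors.\<close>
    have lin: "c a = a$1 * c (axis 1 1) + a$2 * c (axis 2 1) + a$3 * c (axis 3 1)" for a
      unfolding c_def matrix_matrix_mult_def skew_def using exhaust_3[of i] exhaust_3[of j]
      by (auto simp: sum_3 algebra_simps axis_def)
    note eq = cocycle[of _ _ i j, folded c_def]
    have 1: "l$3 * B$i$j = l$2 * c (axis 1 1) - l$1 * c (axis 2 1)"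
      using eq[of "axis 1 1" "axis 2 1"] by (simp add: scalar_product_def matrix_vector_mult_def sum_3 axis_def skew_def)
    have 2: "l$1 * B$i$j = l$3 * c (axis 2 1) - l$2 * c (axis 3 1)"
      using eq[of "axis 2 1" "axis 3 1"] by (simp add: scalar_product_def matrix_vector_mult_def sum_3 axis_def skew_def)
    have 3: "l$2 * B$i$j = l$1 * c (axis 3 1) - l$3 * c (axis 1 1)"
      using eq[of "axis 3 1" "axis 1 1"] by (simp add: scalar_product_def matrix_vector_mult_def sum_3 axis_def skew_def)
    have "scalar_product l v * B$i$j = v$1 * (l$1 * B$i$j) + v$2 * (l$2 * B$i$j) + v$3 * (l$3 * B$i$j)"
      by (simp add: scalar_product_def sum_3 algebra_simps)
    also have "\<dots> = c (skew l *v v)"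
      unfolding 1 2 3 lin[of "skew l *v v"]
      by (simp add: matrix_vector_mult_def sum_3 skew_def algebra_simps)
    finally show ?thesis by (simp add: c_def)
  qed
  define b where "b x y = scalar_product x (B *v y)" for x y
  have "scalar_product l v * b x y = - scalar_product l x * b v y + scalar_product v x * b l y
     - scalar_product l y * b x v + scalar_product v y * b x l" for v x y
  proof -
    have "scalar_product l v * b x y = scalar_product x ((\<chi> i j. scalar_product l v * B$i$j) *v y)"
      unfolding b_def by (simp add: scalar_product_def matrix_vector_mult_def sum_3 algebra_simps)
    also have "(\<chi> i j. scalar_product l v * B$i$j) = skew (skew l *v v) ** B - B ** skew (skew l *v v)"
      by (simp add: ev vec_eq_iff)
    finally show ?thesis unfolding matrix_form_double_cross b_def .
  qed
  from double_cross_eigenform_zero[OF two three l this]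
  have "b (axis i 1) (axis j 1) = 0" for i j .
  moreover have "b (axis i 1) (axis j 1) = B$i$j" for i j
    using exhaust_3[of i] exhaust_3[of j]
    by (auto simp: b_def scalar_product_def matrix_vector_mult_def axis_def sum_3)
  ultimately show ?thesis by (simp add: vec_eq_iff)
qed

text \<open>
  The whole argument in coordinates: \<open>D\<close> is the comultiplication and \<open>skew a *v b\<close> the bracket of
  \<open>a\<close> and \<open>b\<close>.
\<close>

theorem linear_comultiplication_zero:
  fixes D :: "'k::field^3 \<Rightarrow> 'k^3^3"
  assumes two: "(2::'k) \<noteq> 0" and three: "(3::'k) \<noteq> 0"
    and add: "\<And>a b. D (a + b) = D a + D b"
    and smult: "\<And>c a. D (c *s a) = (\<chi> i j. c * D a$i$j)"
    and comult: "\<And>a b. 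
      skew_tensor (D (skew a *v b)) =
      ((kron (skew a) (mat 1) + kron (mat 1) (skew a)) ** skew_tensor (D b)
        - skew_tensor (D b) ** (kron (skew a) (mat 1) + kron (mat 1) (skew a)))
      + (skew_tensor (D a) ** (kron (skew b) (mat 1) + kron (mat 1) (skew b))
        - (kron (skew b) (mat 1) + kron (mat 1) (skew b)) ** skew_tensor (D a))
      + (skew_tensor (D a) ** skew_tensor (D b) - skew_tensor (D b) ** skew_tensor (D a))"
  shows "D a = 0"
proof (rule ccontr)
  assume "D a \<noteq> 0"
  then obtain p j where nz: "D a $ p $ j \<noteq> 0" by (auto simp: vec_eq_iff)
  let ?ad = "\<lambda>a M. skew a ** M - M ** skew a"
  have sep: "D (skew x *v y) - ?ad x (D y) + ?ad y (D x) = 0 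
    \<and> skew_tensor (D x) ** skew_tensor (D y) = skew_tensor (D y) ** skew_tensor (D x)" for x y
  proof (rule skew_tensor_separates[OF two])
    show "skew_tensor (D (skew x *v y) - ?ad x (D y) + ?ad y (D x)) =
       skew_tensor (D x) ** skew_tensor (D y) - skew_tensor (D y) ** skew_tensor (D x)"
      unfolding skew_tensor_linear(1) skew_tensor_linear(2)[of "D (skew x *v y)"] comult[of x y] commutator_skew_tensor[symmetric]
      by simp
  qed
  \<comment> \<open>The linear form \<open>\<lambda>\<close>, normalised by \<open>\<lambda>(a) = 1\<close>; the matrix \<open>B\<close> is \<open>D a\<close>.\<close>
  define l where "l = (\<chi> i. D (axis i 1) $ p $ j / D a $ p $ j)"
  have lin: "D x $ p $ j = scalar_product l x * D a $ p $ j" for x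
  proof -
    have "x = x$1 *s axis 1 1 + x$2 *s axis 2 1 + x$3 *s axis 3 1"
      by (simp add: vec_eq_iff forall_3 axis_def)
    then have "D x = D (x$1 *s axis 1 1 + x$2 *s axis 2 1 + x$3 *s axis 3 1)" by simp
    then show ?thesis using nz by (simp add: add smult l_def scalar_product_def sum_3 algebra_simps)
  qed
  have D: "D x $ q $ r = scalar_product l x * D a $ q $ r" for x q r
  proof -
    have "D a$p$j * D x$q$r = D a$q$r * D x$p$j"
      by (rule skew_tensor_commute_imp_proportional[OF two]) (use sep in blast)
    then show ?thesis using nz lin[of x] by simp
  qed
  have "l \<noteq> 0"
    using lin[of a] nz by (auto simp: scalar_product_def)
  have adD: "?ad x (D y) $ q $ r = scalar_product l y * (?ad x (D a) $ q $ r)" for x y q r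
    by (simp add: matrix_matrix_mult_def D[of y] sum_3 algebra_simps)
  have "scalar_product l (skew x *v y) * D a$q$r =
       scalar_product l y * ?ad x (D a)$q$r - scalar_product l x * ?ad y (D a)$q$r" for x y q r
  proof -
    have "(D (skew x *v y) - ?ad x (D y) + ?ad y (D x)) $ q $ r = 0" using sep by simp
    then show ?thesis
      unfolding vector_add_component vector_minus_component[of "D (skew x *v y)"] vector_minus_component[of "D (skew x *v y) $ q"] adD[of x y] adD[of y x] D[of "skew x *v y"]
      by (simp add: algebra_simps)
  qed
  from rank_one_cocycle_imp_zero[OF two three \<open>l \<noteq> 0\<close> this] nz show False by simp
qed

section \<open>Tensors in coordinates\<close>

lemma tensor_class_bilinear:
  fixes V :: "('k::field, 'v, 'x) module_scheme" and W :: "('k, 'w, 'y) module_scheme"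
  assumes V: "module scalars V" and W: "module scalars W"
  defines "cl p \<equiv> tensor_kernel V W +>\<^bsub>(monoid_algebra (V \<times>\<times> W) :: ('k, 'v \<times> 'w \<Rightarrow>\<^sub>0 'k) module)\<^esub> p"
  shows "\<lbrakk>x \<in> carrier V; x' \<in> carrier V; y \<in> carrier W\<rbrakk> \<Longrightarrow>
      cl (Poly_Mapping.single (x \<oplus>\<^bsub>V\<^esub> x', y) a) = cl (Poly_Mapping.single (x, y) a + Poly_Mapping.single (x', y) a)"
    "\<lbrakk>x \<in> carrier V; y \<in> carrier W; y' \<in> carrier W\<rbrakk> \<Longrightarrow>
      cl (Poly_Mapping.single (x, y \<oplus>\<^bsub>W\<^esub> y') a) = cl (Poly_Mapping.single (x, y) a + Poly_Mapping.single (x, y') a)"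
    "\<lbrakk>x \<in> carrier V; y \<in> carrier W\<rbrakk> \<Longrightarrow>
      cl (Poly_Mapping.single (c \<odot>\<^bsub>V\<^esub> x, y) a) = cl (Poly_Mapping.single (x, y) (a * c))"
    "\<lbrakk>x \<in> carrier V; y \<in> carrier W\<rbrakk> \<Longrightarrow>
      cl (Poly_Mapping.single (x, c \<odot>\<^bsub>W\<^esub> y) a) = cl (Poly_Mapping.single (x, y) (a * c))"
proof -
  note K = tensor_kernel_submodule[OF V W]
  have scaled: "scale a r \<in> tensor_kernel V W" if "r \<in> tensor_relations V W" for r
    using that tensor_relations_subset[OF V W] submodule_monoid_algebraD(4)[OF K] by blast
  show "cl (Poly_Mapping.single (x \<oplus>\<^bsub>V\<^esub> x', y) a) = cl (Poly_Mapping.single (x, y) a + Poly_Mapping.single (x', y) a)"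
    if "x \<in> carrier V" "x' \<in> carrier V" "y \<in> carrier W"
  proof -
    have "Poly_Mapping.single (x \<oplus>\<^bsub>V\<^esub> x', y) 1 - Poly_Mapping.single (x, y) 1 - Poly_Mapping.single (x', y) 1 \<in> tensor_relations V W"
      using that unfolding tensor_relations_def by blast
    from scaled[OF this] show ?thesis
      by (simp add: cl_def coset_eq_iff[OF K] scale_diff scale_add diff_diff_eq)
  qed
  show "cl (Poly_Mapping.single (x, y \<oplus>\<^bsub>W\<^esub> y') a) = cl (Poly_Mapping.single (x, y) a + Poly_Mapping.single (x, y') a)"
    if "x \<in> carrier V" "y \<in> carrier W" "y' \<in> carrier W"
  proof -
    have "Poly_Mapping.single (x, y \<oplus>\<^bsub>W\<^esub> y') 1 - Poly_Mapping.single (x, y) 1 - Poly_Mapping.single (x, y') 1 \<in> tensor_relations V W"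
      using that unfolding tensor_relations_def by blast
    from scaled[OF this] show ?thesis
      by (simp add: cl_def coset_eq_iff[OF K] scale_diff scale_add diff_diff_eq)
  qed
  show "cl (Poly_Mapping.single (c \<odot>\<^bsub>V\<^esub> x, y) a) = cl (Poly_Mapping.single (x, y) (a * c))"
    if "x \<in> carrier V" "y \<in> carrier W"
  proof -
    have "Poly_Mapping.single (c \<odot>\<^bsub>V\<^esub> x, y) 1 - Poly_Mapping.single (x, y) c \<in> tensor_relations V W"
      using that unfolding tensor_relations_def by blast
    from scaled[OF this] show ?thesis
      by (simp add: cl_def coset_eq_iff[OF K] scale_diff)
  qed
  show "cl (Poly_Mapping.single (x, c \<odot>\<^bsub>W\<^esub> y) a) = cl (Poly_Mapping.single (x, y) (a * c))"
    if "x \<in> carrier V" "y \<in> carrier W"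
  proof -
    have "Poly_Mapping.single (x, c \<odot>\<^bsub>W\<^esub> y) 1 - Poly_Mapping.single (x, y) c \<in> tensor_relations V W"
      using that unfolding tensor_relations_def by blast
    from scaled[OF this] show ?thesis
      by (simp add: cl_def coset_eq_iff[OF K] scale_diff)
  qed
qed

text \<open>
  The matrix of coefficients of \<open>x \<otimes> y\<close>.
\<close>

definition coord_form :: "('v \<Rightarrow> 'k::field^'n) \<Rightarrow> 'v \<times> 'v \<Rightarrow> 'k^'n^'n" where
  "coord_form \<kappa> = (\<lambda>(x, y). \<chi> i j. \<kappa> x $ i * \<kappa> y $ j)"

text \<open>
  A tensor is the combination of the \<open>e i \<otimes> e j\<close> given by its matrix. So no tensor is lost when it is replaced by its
  matrix.
\<close>

lemma tensor_zero_if_coords_zero: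
  fixes L :: "('k::field, 'v, 'x) module_scheme" and \<kappa> :: "'v \<Rightarrow> 'k^3" and e :: "3 \<Rightarrow> 'v"
  assumes L: "module scalars L"
    and e: "\<And>i. e i \<in> carrier L"
    and expand: "\<And>x. x \<in> carrier L \<Longrightarrow>
      x = \<kappa> x $ 1 \<odot>\<^bsub>L\<^esub> e 1 \<oplus>\<^bsub>L\<^esub> (\<kappa> x $ 2 \<odot>\<^bsub>L\<^esub> e 2 \<oplus>\<^bsub>L\<^esub> \<kappa> x $ 3 \<odot>\<^bsub>L\<^esub> e 3)"
    and p: "p \<in> carrier (monoid_algebra (L \<times>\<times> L))" and zero: "matrix_eval (coord_form \<kappa>) p = 0"
  shows "tensor_kernel L L +>\<^bsub>(monoid_algebra (L \<times>\<times> L) :: ('k, 'v \<times> 'v \<Rightarrow>\<^sub>0 'k) module)\<^esub> p = \<zero>\<^bsub>tensor L L\<^esub>"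
proof -
  let ?A = "monoid_algebra (L \<times>\<times> L) :: ('k, 'v \<times> 'v \<Rightarrow>\<^sub>0 'k) module"
  define cl where "cl p = tensor_kernel L L +>\<^bsub>?A\<^esub> p" for p
  note K = tensor_kernel_submodule[OF L L]
  note add = add_quotient[OF K, folded cl_def]
  interpret L: module scalars L by (rule L)
  have sc: "c \<odot>\<^bsub>L\<^esub> x \<in> carrier L" if "x \<in> carrier L" for c x
    using L.smult_closed[of c x] that by (simp add: scalars_def)
  have s: "Poly_Mapping.single (x, y) c \<in> carrier ?A" if "x \<in> carrier L" "y \<in> carrier L" for x y c
    using that by (simp add: single_carrier)
  note rules = tensor_class_bilinear[OF L L, folded cl_def]
  have cl_add: "cl (p + q) = cl (p' + q')"
    if "p \<in> carrier ?A" "q \<in> carrier ?A" "p' \<in> carrier ?A" "q' \<in> carrier ?A" "cl p = cl p'" "cl q = cl q'" for p q p' q'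
    using that add by metis
  have sum_carrier: "(\<Sum>i\<in>UNIV. f i) \<in> carrier ?A" if "\<And>i. f i \<in> carrier ?A" for f :: "3 \<Rightarrow> _"
    using that by (simp add: sum_3 add_carrier)
  have sum_cong: "cl (\<Sum>i\<in>UNIV. f i) = cl (\<Sum>i\<in>UNIV. g i)"
    if "\<And>i. f i \<in> carrier ?A" "\<And>i. g i \<in> carrier ?A" "\<And>i. cl (f i) = cl (g i)" for f g :: "3 \<Rightarrow> _"
    unfolding sum_3 by (intro cl_add add_carrier that)
  \<comment> \<open>Expand first one argument and then the other in the basis.\<close>
  have left: "cl (Poly_Mapping.single (x, y) a) = cl (\<Sum>i\<in>UNIV. Poly_Mapping.single (e i, y) (a * \<kappa> x $ i))"
    if x: "x \<in> carrier L" and y: "y \<in> carrier L" for x y a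
  proof -
    have "cl (Poly_Mapping.single (x, y) a) = cl (Poly_Mapping.single (\<kappa> x $ 1 \<odot>\<^bsub>L\<^esub> e 1, y) a +
       Poly_Mapping.single (\<kappa> x $ 2 \<odot>\<^bsub>L\<^esub> e 2 \<oplus>\<^bsub>L\<^esub> \<kappa> x $ 3 \<odot>\<^bsub>L\<^esub> e 3, y) a)"
      by (subst (1) expand[OF x]) (intro rules sc e y L.M.a_closed)
    also have "\<dots> = cl (Poly_Mapping.single (e 1, y) (a * \<kappa> x $ 1) +
        (Poly_Mapping.single (\<kappa> x $ 2 \<odot>\<^bsub>L\<^esub> e 2, y) a + Poly_Mapping.single (\<kappa> x $ 3 \<odot>\<^bsub>L\<^esub> e 3, y) a))"
      by (intro cl_add s add_carrier rules sc e y L.M.a_closed)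
    also have "\<dots> = cl (Poly_Mapping.single (e 1, y) (a * \<kappa> x $ 1) +
        (Poly_Mapping.single (e 2, y) (a * \<kappa> x $ 2) + Poly_Mapping.single (e 3, y) (a * \<kappa> x $ 3)))"
      by (intro cl_add s add_carrier rules sc e y refl)
    finally show ?thesis by (simp add: sum_3 add.assoc)
  qed
  have right: "cl (Poly_Mapping.single (x, y) a) = cl (\<Sum>i\<in>UNIV. Poly_Mapping.single (x, e i) (a * \<kappa> y $ i))"
    if x: "x \<in> carrier L" and y: "y \<in> carrier L" for x y a
  proof -
    have "cl (Poly_Mapping.single (x, y) a) = cl (Poly_Mapping.single (x, \<kappa> y $ 1 \<odot>\<^bsub>L\<^esub> e 1) a +
       Poly_Mapping.single (x, \<kappa> y $ 2 \<odot>\<^bsub>L\<^esub> e 2 \<oplus>\<^bsub>L\<^esub> \<kappa> y $ 3 \<odot>\<^bsub>L\<^esub> e 3) a)"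
      by (subst (1) expand[OF y]) (intro rules sc e x L.M.a_closed)
    also have "\<dots> = cl (Poly_Mapping.single (x, e 1) (a * \<kappa> y $ 1) +
        (Poly_Mapping.single (x, \<kappa> y $ 2 \<odot>\<^bsub>L\<^esub> e 2) a + Poly_Mapping.single (x, \<kappa> y $ 3 \<odot>\<^bsub>L\<^esub> e 3) a))"
      by (intro cl_add s add_carrier rules sc e x L.M.a_closed)
    also have "\<dots> = cl (Poly_Mapping.single (x, e 1) (a * \<kappa> y $ 1) +
        (Poly_Mapping.single (x, e 2) (a * \<kappa> y $ 2) + Poly_Mapping.single (x, e 3) (a * \<kappa> y $ 3)))"
      by (intro cl_add s add_carrier rules sc e x refl)
    finally show ?thesis by (simp add: sum_3 add.assoc)
  qed
  define F :: "('v \<times> 'v \<Rightarrow>\<^sub>0 'k) \<Rightarrow> ('v \<times> 'v \<Rightarrow>\<^sub>0 'k)"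
    where "F q = (\<Sum>i\<in>UNIV. \<Sum>j\<in>UNIV. Poly_Mapping.single (e i, e j) (matrix_eval (coord_form \<kappa>) q $ i $ j))" for q
  have Fc: "F q \<in> carrier ?A" for q
    unfolding F_def by (intro sum_carrier s e)
  have "cl p = cl (F p)"
    using p[unfolded carrier_monoid_algebra]
  proof (induction p rule: keys_subset_induct)
    case zero
    then show ?case by (simp add: F_def matrix_eval_zero)
  next
    case (single m a)
    obtain x y where m: "m = (x, y)" "x \<in> carrier L" "y \<in> carrier L" using single by auto
    have "cl (Poly_Mapping.single m a) = cl (\<Sum>i\<in>UNIV. Poly_Mapping.single (e i, y) (a * \<kappa> x $ i))"
      using left m by simp
    also have "\<dots> = cl (\<Sum>i\<in>UNIV. \<Sum>j\<in>UNIV. Poly_Mapping.single (e i, e j) (a * \<kappa> x $ i * \<kappa> y $ j))"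
      by (intro sum_cong sum_carrier s e m right)
    finally show ?case by (simp add: F_def m matrix_eval_single coord_form_def mult.assoc)
  next
    case (add p q)
    have "F (p + q) = F p + F q"
      by (simp add: F_def matrix_eval_add single_add sum.distrib)
    then show ?case using add by (simp add: cl_add[OF _ _ Fc Fc] carrier_monoid_algebra)
  qed
  also have "F p = 0" by (simp add: F_def zero)
  finally show ?thesis
    by (simp add: cl_def tensor_def coset_zero[OF K] zero_quotient[OF K])
qed

lemma matrix_eval_kron_skew:
  fixes \<kappa> :: "'v \<Rightarrow> 'k::field^3"
  shows "matrix_eval (\<lambda>(x, y). kron (skew (\<kappa> x)) (skew (\<kappa> y))) p = skew_tensor (matrix_eval (coord_form \<kappa>) p)"
proof (induction p rule: keys_subset_induct[OF subset_UNIV, case_names zero single add])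
  case zero
  show ?case by (simp add: matrix_eval_zero skew_tensor_def vec_eq_iff)
next
  case (single m a)
  obtain x y where m: "m = (x, y)" by (cases m)
  have "kron (skew (\<kappa> x)) (skew (\<kappa> y)) = skew_tensor (\<chi> i j. \<kappa> x $ i * \<kappa> y $ j)"
    by (simp add: vec_eq_iff kron_def skew_tensor_matrix)
  then show ?case
    using skew_tensor_linear(3)[of a "\<chi> i j. \<kappa> x $ i * \<kappa> y $ j"]
    by (simp add: m matrix_eval_single coord_form_def)
qed (simp add: matrix_eval_add skew_tensor_linear)

section \<open>The Lie algebra sl2\<close>

lemma sl2_simps:
  "A \<in> carrier sl2 \<longleftrightarrow> trace A = 0"
  "A \<oplus>\<^bsub>sl2\<^esub> B = A + B"
  "c \<odot>\<^bsub>sl2\<^esub> A = (\<chi> i j. c * A $ i $ j)"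
  "A \<otimes>\<^bsub>sl2\<^esub> B = A ** B - B ** A"
  "\<zero>\<^bsub>sl2\<^esub> = 0"
  by (simp_all add: sl2_def)

lemma trace_2: "trace (A :: 'k::comm_ring_1^2^2) = A$1$1 + A$2$2"
  by (simp add: trace_def sum_2)

text \<open>
  If \<open>2 = 0\<close>, then scalar matrices have trace zero and form a proper nonzero ideal.
\<close>

lemma simple_sl2_imp_two_neq_zero:
  assumes "simple_lie_algebra (sl2 :: ('k::field, 'k^2^2) module)"
  shows "(2::'k) \<noteq> 0"
proof
  assume two: "(2::'k) = 0"
  have double: "c + c = 0" for c :: 'k using two by (metis mult_2 mult_zero_left)
  let ?I = "range (mat :: 'k \<Rightarrow> 'k^2^2)"
  interpret L: lie_algebra "sl2 :: ('k, 'k^2^2) module" using assms by (simp add: simple_lie_algebra_def)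
  have in_carrier: "?I \<subseteq> carrier sl2"
    by (auto simp: sl2_simps trace_2 mat_def double)
  have "submodule ?I scalars (sl2 :: ('k, 'k^2^2) module)"
  proof (rule L.submoduleI[OF in_carrier])
    show "\<zero>\<^bsub>sl2\<^esub> \<in> ?I" by (auto simp: sl2_simps mat_def vec_eq_iff intro!: image_eqI[of _ _ 0])
    fix A B assume A: "A \<in> ?I" and B: "B \<in> ?I"
    have "A \<oplus>\<^bsub>sl2\<^esub> A = \<zero>\<^bsub>sl2\<^esub>" using A by (auto simp: sl2_simps mat_def vec_eq_iff two)
    then have "\<ominus>\<^bsub>sl2\<^esub> A = A" using A in_carrier by (intro L.minus_equality) auto
    then show "\<ominus>\<^bsub>sl2\<^esub> A \<in> ?I" using A by simp
    from A B obtain a b where "A = mat a" "B = mat b" by auto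
    then have "A \<oplus>\<^bsub>sl2\<^esub> B = mat (a + b)" by (simp add: sl2_simps mat_def vec_eq_iff)
    then show "A \<oplus>\<^bsub>sl2\<^esub> B \<in> ?I" by simp
  next
    fix c A assume "A \<in> ?I"
    then obtain a where "A = mat a" by auto
    then have "c \<odot>\<^bsub>sl2\<^esub> A = mat (c * a)" by (simp add: sl2_simps mat_def vec_eq_iff)
    then show "c \<odot>\<^bsub>sl2\<^esub> A \<in> ?I" by simp
  qed
  moreover have "A \<otimes>\<^bsub>sl2\<^esub> B \<in> ?I" if "B \<in> ?I" for A B
  proof -
    have "A \<otimes>\<^bsub>sl2\<^esub> B = mat 0"
      using that by (auto simp: sl2_simps mat_def vec_eq_iff matrix_matrix_mult_def sum_2 forall_2 mult.commute)
    then show ?thesis by (metis rangeI)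
  qed
  ultimately have "lie_ideal ?I (sl2 :: ('k, 'k^2^2) module)" by (simp add: lie_ideal_def)
  then have "?I = {\<zero>\<^bsub>sl2\<^esub>} \<or> ?I = carrier sl2" using assms by (simp add: simple_lie_algebra_def)
  moreover have "mat 1 \<noteq> (0 :: 'k^2^2)" by (simp add: mat_def vec_eq_iff forall_2)
  \<comment> \<open>The ideal is proper: an off-diagonal matrix unit has trace zero and is not scalar.\<close>
  moreover have "(\<chi> i j. if i = 1 \<and> j = 2 then 1 else 0) \<in> carrier (sl2 :: ('k, 'k^2^2) module)"
    by (simp add: sl2_simps trace_2)
  moreover have "(\<chi> i j. if i = 1 \<and> j = 2 then 1 else 0) \<notin> ?I"
    by (auto simp: mat_def vec_eq_iff forall_2)
  ultimately show False by (auto simp: sl2_simps)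
qed

text \<open>
  Coordinates in which the bracket is the cross product. For \<open>\<omega>\<^sup>2 = -1\<close> they belong to the basis of Pauli
  matrices divided by \<open>2 \<omega>\<close>; the inverse is \<open>sl2_of_coords\<close>.
\<close>

definition sl2_coords :: "'k::field \<Rightarrow> 'k^2^2 \<Rightarrow> 'k^3" where
  "sl2_coords \<omega> A = vector [\<omega> * (A$1$2 + A$2$1), A$2$1 - A$1$2, 2 * \<omega> * A$1$1]"

definition sl2_of_coords :: "'k::field \<Rightarrow> 'k^3 \<Rightarrow> 'k^2^2" where
  "sl2_of_coords \<omega> v = vector [vector [- (\<omega> * v$3 / 2), - ((\<omega> * v$1 + v$2) / 2)],
      vector [(v$2 - \<omega> * v$1) / 2, \<omega> * v$3 / 2]]"

lemma sl2_coords_linear: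
  "sl2_coords \<omega> (A + B) = sl2_coords \<omega> A + sl2_coords \<omega> B"
  "sl2_coords \<omega> (\<chi> i j. c * A $ i $ j) = c *s sl2_coords \<omega> A"
  by (simp_all add: sl2_coords_def vec_eq_iff forall_3 algebra_simps)

lemma sl2_coords_bracket:
  fixes \<omega> :: "'k::field"
  assumes i2: "\<omega> * \<omega> = -1" and tr: "trace A = 0" "trace B = 0"
  shows "sl2_coords \<omega> (A ** B - B ** A) = skew (sl2_coords \<omega> A) *v sl2_coords \<omega> B"
proof -
  have i2': "\<omega> * (\<omega> * x) = - x" for x by (simp add: i2 flip: mult.assoc)
  have "A$2$2 = - (A$1$1)" "B$2$2 = - (B$1$1)" using tr by (simp_all add: trace_2 eq_neg_iff_add_eq_0 add.commute)
  then show ?thesis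
    by (simp add: sl2_coords_def skew_def vec_eq_iff forall_3 matrix_matrix_mult_def matrix_vector_mult_def sum_2 sum_3
       i2' algebra_simps)
qed

lemma sl2_of_coords_iso:
  fixes \<omega> :: "'k::field"
  assumes i2: "\<omega> * \<omega> = -1" and two: "(2::'k) \<noteq> 0"
  shows
  "sl2_of_coords \<omega> v \<in> carrier sl2"
  "sl2_coords \<omega> (sl2_of_coords \<omega> v) = v"
  "A \<in> carrier sl2 \<Longrightarrow> sl2_of_coords \<omega> (sl2_coords \<omega> A) = A"
  "sl2_of_coords \<omega> (v + w) = sl2_of_coords \<omega> v + sl2_of_coords \<omega> w"
  "sl2_of_coords \<omega> (c *s v) = (\<chi> i j. c * sl2_of_coords \<omega> v $ i $ j)"
proof -
  have i2': "\<omega> * (\<omega> * x) = - x" for x by (simp add: i2 flip: mult.assoc)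
  have "(4::'k) = 2 * 2" by simp
  then have four: "(4::'k) \<noteq> 0" using two by (metis mult_eq_0_iff)
  show "sl2_of_coords \<omega> v \<in> carrier sl2" by (simp add: sl2_simps trace_2 sl2_of_coords_def)
  show "sl2_coords \<omega> (sl2_of_coords \<omega> v) = v"
    using two four by (simp add: sl2_of_coords_def sl2_coords_def vec_eq_iff forall_3 field_simps i2')
  show "sl2_of_coords \<omega> (v + w) = sl2_of_coords \<omega> v + sl2_of_coords \<omega> w"
    "sl2_of_coords \<omega> (c *s v) = (\<chi> i j. c * sl2_of_coords \<omega> v $ i $ j)"
    using two four by (simp_all add: sl2_of_coords_def vec_eq_iff forall_2 field_simps)
  show "sl2_of_coords \<omega> (sl2_coords \<omega> A) = A" if "A \<in> carrier sl2"
  proof -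
    have "A$2$2 = - (A$1$1)" using that by (simp add: sl2_simps trace_2 eq_neg_iff_add_eq_0 add.commute)
    then show ?thesis using two four by (simp add: sl2_of_coords_def sl2_coords_def vec_eq_iff forall_2 field_simps i2')
  qed
qed

lemma commutator_skew:
  "skew v ** skew w - skew w ** skew v = skew (skew v *v w)"
  by (simp add: skew_def matrix_matrix_mult_def matrix_vector_mult_def vec_eq_iff forall_3 sum_3 algebra_simps)

text \<open>
  The adjoint representation.
\<close>

lemma lie_representation_sl2:
  fixes \<omega> :: "'k::field"
  assumes i2: "\<omega> * \<omega> = -1"
  shows "lie_representation sl2 (\<lambda>A. skew (sl2_coords \<omega> A))"
  unfolding lie_representation_def
  by (auto simp: sl2_simps sl2_coords_linear sl2_coords_bracket[OF i2] commutator_skew[symmetric])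
    (simp_all add: skew_def vec_eq_iff forall_3)

section \<open>Rigidity\<close>

theorem theorem3p9:
  assumes "simple_lie_algebra (sl2 :: ('k::alg_closed_field, 'k^2^2) module)"
    and "CHAR('k) \<noteq> 3"
  shows "rigid (sl2 :: ('k, 'k^2^2) module)"
  unfolding rigid_def
proof (intro allI impI ballI)
  let ?L = "sl2 :: ('k, 'k^2^2) module"
  have two: "(2::'k) \<noteq> 0" by (rule simple_sl2_imp_two_neq_zero[OF assms(1)])
  have three: "(3::'k) \<noteq> 0"
  proof
    assume "(3::'k) = 0"
    then have "CHAR('k) dvd 3" using of_nat_eq_0_iff_char_dvd[of 3, where 'a = 'k] by simp
    moreover have "prime (3::nat)" by simp
    ultimately have "CHAR('k) = 1 \<or> CHAR('k) = 3" by (metis prime_nat_iff)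
    then show False using assms(2) by simp
  qed
  obtain \<omega> :: 'k where "\<omega> ^ 2 = -1" using nth_root_exists[of 2 "-1 :: 'k"] by auto
  then have \<omega>: "\<omega> * \<omega> = -1" by (simp add: power2_eq_square)
  note S = sl2_of_coords_iso[OF \<omega> two]
  define \<kappa> where "\<kappa> = sl2_coords \<omega>"
  define e where "e = sl2_of_coords \<omega>"
  note S = S[folded \<kappa>_def e_def]
  fix \<delta> and x :: "'k^2^2" assume coassoc: "coassociative_lie_algebra ?L \<delta>" and x: "x \<in> carrier ?L"
  interpret coassociative_lie_algebra ?L \<delta> by (rule coassoc)
  interpret lie_rep ?L "\<lambda>A. skew (\<kappa> A)"
    by unfold_locales (simp add: \<kappa>_def lie_representation_sl2[OF \<omega>])
  note K = tensor_kernel_submodule[OF module_L module_L]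
  let ?A = "monoid_algebra (?L \<times>\<times> ?L) :: ('k, ('k^2^2) \<times> ('k^2^2) \<Rightarrow>\<^sub>0 'k) module"
  have kernel: "matrix_eval (coord_form \<kappa>) h = 0" if "h \<in> tensor_kernel ?L ?L" for h
    by (intro tensor_kernel_eval[OF module_L module_L _ _ _ _ that])
      (simp_all add: coord_form_def sl2_simps \<kappa>_def sl2_coords_linear vec_eq_iff algebra_simps)
  have \<delta>: "\<delta> a \<in> carrier (tensor ?L ?L)" if "a \<in> carrier ?L" for a
    using comult_linear that by (auto simp: linear_maps_def)
  have lin: "\<delta> (a \<oplus>\<^bsub>?L\<^esub> b) = \<delta> a \<oplus>\<^bsub>tensor ?L ?L\<^esub> \<delta> b" "\<delta> (c \<odot>\<^bsub>?L\<^esub> a) = c \<odot>\<^bsub>tensor ?L ?L\<^esub> \<delta> a"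
    if "a \<in> carrier ?L" "b \<in> carrier ?L" for a b c
    using comult_linear that by (auto simp: linear_maps_def)
  have tensor_rep: "tensor_rep X = skew_tensor (class_eval (coord_form \<kappa>) X)"
    if X: "X \<in> carrier (tensor ?L ?L)" for X
  proof -
    obtain p where "p \<in> carrier ?A" "X = tensor_kernel ?L ?L +>\<^bsub>?A\<^esub> p" using X by (rule tensor_cases[OF module_L module_L])
    then show ?thesis
      by (simp add: tensor_rep_coset class_eval_coset[OF K kernel] matrix_eval_kron_skew)
  qed
  define D where "D v = class_eval (coord_form \<kappa>) (\<delta> (e v))" for v
  note ce = class_eval_tensor_linear[OF module_L module_L kernel]
  have "D v = 0" for v
  proof (rule linear_comultiplication_zero[OF two three])
    fix a b :: "'k^3" and c :: 'k
    show "D (a + b) = D a + D b"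
      using lin(1)[of "e a" "e b"] S(1) by (simp add: D_def S(4) ce \<delta> sl2_simps(2))
    show "D (c *s a) = (\<chi> i j. c * D a $ i $ j)"
      using lin(2)[of "e a" "e a" c] S(1) by (simp add: D_def S(5) ce(2)[OF _ \<delta>] sl2_simps(3))
    have t: "tensor_rep (\<delta> y) = skew_tensor (D (\<kappa> y))" if "y \<in> carrier ?L" for y
      using that by (simp add: tensor_rep \<delta> D_def S(3))
    have br: "\<kappa> (e a \<otimes>\<^bsub>?L\<^esub> e b) = skew a *v b"
      using S(1)[of a] S(1)[of b] sl2_coords_bracket[OF \<omega>, of "e a" "e b"] S(2) by (simp add: sl2_simps \<kappa>_def)
    show "skew_tensor (D (skew a *v b)) =
      ((kron (skew a) (mat 1) + kron (mat 1) (skew a)) ** skew_tensor (D b)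
        - skew_tensor (D b) ** (kron (skew a) (mat 1) + kron (mat 1) (skew a)))
      + (skew_tensor (D a) ** (kron (skew b) (mat 1) + kron (mat 1) (skew b))
        - (kron (skew b) (mat 1) + kron (mat 1) (skew b)) ** skew_tensor (D a))
      + (skew_tensor (D a) ** skew_tensor (D b) - skew_tensor (D b) ** skew_tensor (D a))"
      using comult_bracket_rep[OF coassoc S(1)[of a] S(1)[of b]]
      by (simp add: t S(1) bracket_closed br S(2))
  qed
  then have "class_eval (coord_form \<kappa>) (\<delta> x) = 0"
    using x by (metis D_def S(3))
  moreover obtain p where p: "p \<in> carrier ?A" and X: "\<delta> x = tensor_kernel ?L ?L +>\<^bsub>?A\<^esub> p"
    using \<delta>[OF x] by (rule tensor_cases[OF module_L module_L])
  ultimately have zero: "matrix_eval (coord_form \<kappa>) p = 0"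
    by (simp add: class_eval_coset[OF K kernel])
  have expand: "y = \<kappa> y $ 1 \<odot>\<^bsub>?L\<^esub> e (axis 1 1) \<oplus>\<^bsub>?L\<^esub> (\<kappa> y $ 2 \<odot>\<^bsub>?L\<^esub> e (axis 2 1) \<oplus>\<^bsub>?L\<^esub> \<kappa> y $ 3 \<odot>\<^bsub>?L\<^esub> e (axis 3 1))"
    if "y \<in> carrier ?L" for y
  proof -
    have "\<kappa> y = \<kappa> y $ 1 *s axis 1 1 + (\<kappa> y $ 2 *s axis 2 1 + \<kappa> y $ 3 *s axis 3 1)"
      by (simp add: vec_eq_iff forall_3 axis_def)
    then have "e (\<kappa> y) = e (\<kappa> y $ 1 *s axis 1 1 + (\<kappa> y $ 2 *s axis 2 1 + \<kappa> y $ 3 *s axis 3 1))" by (rule arg_cong)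
    then show ?thesis unfolding S(3)[OF that] S(4) S(5) sl2_simps .
  qed
  show "\<delta> x = \<zero>\<^bsub>tensor ?L ?L\<^esub>"
    unfolding X by (rule tensor_zero_if_coords_zero[OF module_L S(1) expand p zero])
qed

end
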